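(* Let $k<\min\{m,n\}$, let $\boldsymbol{U}\in\mathbb{C}^{m\times k}$ and $\boldsymbol{V}\in\mathbb{C}^{k\times n}$ be full rank, let $\boldsymbol{X}=\boldsymbol{U}\boldsymbol{V}\in\mathbb{C}^{m\times n}$ (so $\boldsymbol{X}$ is low rank), and let $\boldsymbol{y}\in\mathbb{C}^m$. Let $\boldsymbol{\beta}_\star$, $\boldsymbol{x}_\star$, $\boldsymbol{b}_\star$ be the optimal solutions (as defined in the context) of $\boldsymbol{X}\boldsymbol{\beta}=\boldsymbol{y}$, $\boldsymbol{U}\boldsymbol{x}=\boldsymbol{y}$, and $\boldsymbol{V}\boldsymbol{b}=\boldsymbol{x}_\star$ respectively. Let the algorithms RK-RK and REK-RK and the quantities $\alpha_U,\alpha_V,\kappa_U^2$ be as defined in the context, with initialization $\boldsymbol{b}_0=\boldsymbol{0}$, $\boldsymbol{x}_0=\boldsymbol{0}$ (and $\boldsymbol{z}_0=\boldsymbol{y}$ for REK-RK). Then, for every iteration $t\ge 1$: (a) If $\boldsymbol{X}\boldsymbol{\beta}=\boldsymbol{y}$ is consistent, then $\boldsymbol{b}_\star=\boldsymbol{\beta}_\star$ and the iterates $\boldsymbol{b}_t$ of RK-RK satisfy $$\mathbb{E}\|\boldsymbol{b}_t-\boldsymbol{\beta}_\star\|^2\le\begin{cases}\alpha_V^t\|\boldsymbol{b}_\star\|^2+(1-\gamma_1)^{-1}\alpha_{\max}^t\dfrac{\|\boldsymbol{x}_\star\|^2}{\|\boldsymbol{V}\|_F^2},&\text{if }\alpha_U\neq\alpha_V,\\[2mm]\alpha_V^t\|\boldsymbol{b}_\star\|^2+t\,\alpha_{\max}^t\dfrac{\|\boldsymbol{x}_\star\|^2}{\|\boldsymbol{V}\|_F^2},&\text{else},\end{cases}$$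 where $\alpha_{\max}=\max\{\alpha_U,\alpha_V\}$ and $\gamma_1=\min\{\alpha_U/\alpha_V,\ \alpha_V/\alpha_U\}$. (b) If $\boldsymbol{X}\boldsymbol{\beta}=\boldsymbol{y}$ is inconsistent, then $\boldsymbol{b}_\star=\boldsymbol{\beta}_\star$ and the iterates $\boldsymbol{b}_t$ of REK-RK satisfy $$\mathbb{E}\|\boldsymbol{b}_t-\boldsymbol{\beta}_\star\|^2\le\begin{cases}\alpha_V^t\|\boldsymbol{b}_\star\|^2+(1-\gamma_2)^{-1}\tilde{\alpha}_{\max}^{t-1}\dfrac{(1+2\kappa_U^2)\|\boldsymbol{x}_\star\|^2}{\|\boldsymbol{V}\|_F^2},&\text{if }\sqrt{\alpha_U}\neq\alpha_V,\\[2mm]\alpha_V^t\|\boldsymbol{b}_\star\|^2+t\,\tilde{\alpha}_{\max}^{t-1}\dfrac{(1+2\kappa_U^2)\|\boldsymbol{x}_\star\|^2}{\|\boldsymbol{V}\|_F^2},&\text{else},\end{cases}$$ where $\tilde{\alpha}_{\max}=\max\{\sqrt{\alpha_U},\alpha_V\}$ and $\gamma_2=\min\{\sqrt{\alpha_U}/\alpha_V,\ \alpha_V/\sqrt{\alpha_U}\}$.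
   Context: Notation. $\|\cdot\|$ is the Euclidean norm, $\|\cdot\|_F$ the Frobenius norm, $\boldsymbol{A}^*$ the conjugate transpose. $\boldsymbol{A}^i$ denotes the $i$-th row of a matrix $\boldsymbol{A}$ (a row vector), $\boldsymbol{A}_{(j)}$ its $j$-th column; for a vector $\boldsymbol{v}$, $\boldsymbol{v}^i$ is its $i$-th entry. For a matrix $\boldsymbol{A}$, $$\alpha_A=1-\frac{\sigma_{\min}^2(\boldsymbol{A})}{\|\boldsymbol{A}\|_F^2},\qquad \kappa_A^2=\frac{\sigma_{\max}^2(\boldsymbol{A})}{\sigma_{\min}^2(\boldsymbol{A})},$$ where $\sigma_{\min}(\boldsymbol{A})$ and $\sigma_{\max}(\boldsymbol{A})$ are the smallest nonzero and the largest singular values of $\boldsymbol{A}$. The convention $0^0=1$ is used. A linear system is consistent if it has at least one solution, and inconsistent otherwise. Optimal solutions (for $k<\min\{m,n\}$, $\boldsymbol{U},\boldsymbol{V}$ full rank). $\boldsymbol{\beta}_\star$ is the least-norm solution of $\boldsymbol{X}\boldsymbol{\beta}=\boldsymbol{y}$ if this system is consistent, and in general the minimizer of $\|\boldsymbol{X}\boldsymbol{\beta}-\boldsymbol{y}\|$ of least Euclidean norm (equivalently $\boldsymbol{\beta}_\star=\boldsymbol{X}^\dagger\boldsymbol{y}$, with $\dagger$ the pseudo-inverse). $\boldsymbol{x}_\star=(\boldsymbol{U}^*\boldsymbol{U})^{-1}\boldsymbol{U}^*\boldsymbol{y}$ is the unique solution, or the least-squares solution, of $\boldsymbol{U}\boldsymbol{x}=\boldsymbol{y}$.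 $\boldsymbol{b}_\star=\boldsymbol{V}^*(\boldsymbol{V}\boldsymbol{V}^* )^{-1}\boldsymbol{x}_\star$ is the least-norm solution of $\boldsymbol{V}\boldsymbol{b}=\boldsymbol{x}_\star$. Algorithm RK-RK. At each iteration $t=1,2,\dots$: choose a row index $i\in\{1,\dots,m\}$ of $\boldsymbol{U}$ with probability $\|\boldsymbol{U}^i\|^2/\|\boldsymbol{U}\|_F^2$ and set $$\boldsymbol{x}_t=\boldsymbol{x}_{t-1}+\frac{\boldsymbol{y}^i-\boldsymbol{U}^i\boldsymbol{x}_{t-1}}{\|\boldsymbol{U}^i\|^2}(\boldsymbol{U}^i)^*;$$ then choose a row index $p\in\{1,\dots,k\}$ of $\boldsymbol{V}$ with probability $\|\boldsymbol{V}^p\|^2/\|\boldsymbol{V}\|_F^2$ and set $$\boldsymbol{b}_t=\boldsymbol{b}_{t-1}+\frac{\boldsymbol{x}_t^p-\boldsymbol{V}^p\boldsymbol{b}_{t-1}}{\|\boldsymbol{V}^p\|^2}(\boldsymbol{V}^p)^*.$$ Algorithm REK-RK. At each iteration $t=1,2,\dots$: choose a row index $i$ of $\boldsymbol{U}$ with probability $\|\boldsymbol{U}^i\|^2/\|\boldsymbol{U}\|_F^2$ and a column index $j\in\{1,\dots,k\}$ of $\boldsymbol{U}$ with probability $\|\boldsymbol{U}_{(j)}\|^2/\|\boldsymbol{U}\|_F^2$, and set $$\boldsymbol{z}_t=\boldsymbol{z}_{t-1}-\frac{\boldsymbol{U}_{(j)}^*\boldsymbol{z}_{t-1}}{\|\boldsymbol{U}_{(j)}\|^2}\boldsymbol{U}_{(j)},\qquad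 \boldsymbol{x}_t=\boldsymbol{x}_{t-1}+\frac{\boldsymbol{y}^i-\boldsymbol{z}_t^i-\boldsymbol{U}^i\boldsymbol{x}_{t-1}}{\|\boldsymbol{U}^i\|^2}(\boldsymbol{U}^i)^*;$$ then choose a row index $p$ of $\boldsymbol{V}$ with probability $\|\boldsymbol{V}^p\|^2/\|\boldsymbol{V}\|_F^2$ and set $$\boldsymbol{b}_t=\boldsymbol{b}_{t-1}+\frac{\boldsymbol{x}_t^p-\boldsymbol{V}^p\boldsymbol{b}_{t-1}}{\|\boldsymbol{V}^p\|^2}(\boldsymbol{V}^p)^*.$$ All random index choices, within and across iterations, are independent. $\mathbb{E}$ is expectation over all random choices. *)

theory Defs
  imports "HOL-Probability.Probability"
begin

text \<open>An \<open>m \<times> n\<close> complex matrix is an element of \<^typ>\<open>complex^'n^'m\<close>; its \<open>i\<close>-th row is \<open>A $ i\<close>.\<close>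

definition conj_transpose :: "complex^'n^'m \<Rightarrow> complex^'m^'n" where
  "conj_transpose A = (\<chi> i j. cnj (A $ j $ i))"

definition frob_norm :: "complex^'n^'m \<Rightarrow> real" where
  "frob_norm A = sqrt (\<Sum>i\<in>UNIV. \<Sum>j\<in>UNIV. (cmod (A $ i $ j))\<^sup>2)"

definition full_rank :: "complex^'n^'m \<Rightarrow> bool" where
  "full_rank A \<longleftrightarrow> rank A = min CARD('m) CARD('n)"

definition consistent :: "complex^'n^'m \<Rightarrow> complex^'m \<Rightarrow> bool" where
  "consistent A c \<longleftrightarrow> (\<exists>x. A *v x = c)"

text \<open>
  Square roots of the eigenvalues of \<open>A\<^sup>* A\<close>. For a wide matrix this set may contain \<open>0\<close> even if
  none of the \<open>min m n\<close> singular values vanishes; this affects neither the largest nor the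
  smallest nonzero element.
\<close>

definition singular_values :: "complex^'n^'m \<Rightarrow> real set" where
  "singular_values A =
     {s. 0 \<le> s \<and> (\<exists>v. v \<noteq> 0 \<and> (conj_transpose A ** A) *v v = of_real (s\<^sup>2) *s v)}"

definition sigma_min :: "complex^'n^'m \<Rightarrow> real" where
  "sigma_min A = Min {s \<in> singular_values A. s \<noteq> 0}"

definition sigma_max :: "complex^'n^'m \<Rightarrow> real" where
  "sigma_max A = Max (singular_values A)"

definition alpha :: "complex^'n^'m \<Rightarrow> real" where
  "alpha A = 1 - (sigma_min A)\<^sup>2 / (frob_norm A)\<^sup>2"

definition kappa_sq :: "complex^'n^'m \<Rightarrow> real" where
  "kappa_sq A = (sigma_max A)\<^sup>2 / (sigma_min A)\<^sup>2"

definition is_lsq :: "complex^'n^'m \<Rightarrow> complex^'m \<Rightarrow> complex^'n \<Rightarrow> bool" where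
  "is_lsq A c x \<longleftrightarrow> (\<forall>x'. norm (A *v x - c) \<le> norm (A *v x' - c))"

text \<open>
  If \<open>A x = c\<close> is consistent, its least-squares solutions are its solutions, so the following is
  then the least-norm solution.
\<close>

definition min_norm_lsq :: "complex^'n^'m \<Rightarrow> complex^'m \<Rightarrow> complex^'n" where
  "min_norm_lsq A c = (THE x. is_lsq A c x \<and> (\<forall>x'. is_lsq A c x' \<longrightarrow> norm x \<le> norm x'))"

definition x_opt :: "complex^'k^'m \<Rightarrow> complex^'m \<Rightarrow> complex^'k" where
  "x_opt U y = matrix_inv (conj_transpose U ** U) *v (conj_transpose U *v y)"

definition b_opt :: "complex^'n^'k \<Rightarrow> complex^'k \<Rightarrow> complex^'n" where
  "b_opt V x = conj_transpose V *v (matrix_inv (V ** conj_transpose V) *v x)"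

definition row_pmf :: "complex^'n^'m \<Rightarrow> 'm pmf" where
  "row_pmf A = embed_pmf (\<lambda>i. (norm (A $ i))\<^sup>2 / (frob_norm A)\<^sup>2)"

definition col_pmf :: "complex^'n^'m \<Rightarrow> 'n pmf" where
  "col_pmf A = embed_pmf (\<lambda>j. (norm (column j A))\<^sup>2 / (frob_norm A)\<^sup>2)"

lemma frob_norm_sq: "(frob_norm A)\<^sup>2 = (\<Sum>i\<in>UNIV. \<Sum>j\<in>UNIV. (cmod (A $ i $ j))\<^sup>2)"
  by (simp add: frob_norm_def sum_nonneg)

lemma norm_vec_sq: "(norm (v :: complex^'n))\<^sup>2 = (\<Sum>j\<in>UNIV. (cmod (v $ j))\<^sup>2)"
  by (simp add: norm_vec_def L2_set_def sum_nonneg)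

lemma frob_norm_sq_rows: "(frob_norm A)\<^sup>2 = (\<Sum>i\<in>UNIV. (norm (A $ i))\<^sup>2)"
  by (simp add: frob_norm_sq norm_vec_sq)

lemma frob_norm_sq_cols: "(frob_norm A)\<^sup>2 = (\<Sum>j\<in>UNIV. (norm (column j A))\<^sup>2)"
  unfolding frob_norm_sq norm_vec_sq column_def by (simp, rule sum.swap)

lemma frob_norm_eq_0_iff: "frob_norm A = 0 \<longleftrightarrow> A = 0"
proof -
  have "frob_norm A = 0 \<longleftrightarrow> (frob_norm A)\<^sup>2 = 0" by simp
  also have "\<dots> \<longleftrightarrow> A = 0"
    unfolding frob_norm_sq_rows by (simp add: sum_nonneg_eq_0_iff vec_eq_iff)
  finally show ?thesis .
qed

lemma pmf_embed_weights:
  fixes w :: "'i::finite \<Rightarrow> real"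
  assumes "\<And>i. 0 \<le> w i" and "c = (\<Sum>i\<in>UNIV. w i)" and "c \<noteq> 0"
  shows "pmf (embed_pmf (\<lambda>i. w i / c)) i = w i / c"
proof (rule pmf_embed_pmf)
  have c: "0 \<le> c" using assms(1,2) by (simp add: sum_nonneg)
  show "0 \<le> w i / c" for i using c assms(1) by simp
  have "(\<Sum>i\<in>UNIV. w i / c) = 1"
    using assms(2,3) by (simp flip: sum_divide_distrib)
  then show "(\<integral>\<^sup>+i. ennreal (w i / c) \<partial>count_space UNIV) = 1"
    using c assms(1) by (simp add: nn_integral_count_space_finite)
qed

lemma pmf_row_pmf:
  assumes "A \<noteq> 0"
  shows "pmf (row_pmf A) i = (norm (A $ i))\<^sup>2 / (frob_norm A)\<^sup>2"
  unfolding row_pmf_def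
  by (rule pmf_embed_weights) (use assms in \<open>auto simp: frob_norm_sq_rows[symmetric] frob_norm_eq_0_iff\<close>)

lemma pmf_col_pmf:
  assumes "A \<noteq> 0"
  shows "pmf (col_pmf A) j = (norm (column j A))\<^sup>2 / (frob_norm A)\<^sup>2"
  unfolding col_pmf_def
  by (rule pmf_embed_weights) (use assms in \<open>auto simp: frob_norm_sq_cols[symmetric] frob_norm_eq_0_iff\<close>)

text \<open>One Kaczmarz update for \<open>A x = c\<close> with row \<open>i\<close>; \<open>(A *v x) $ i\<close> is \<open>A\<^sup>i x\<close>.\<close>

definition rk_step :: "complex^'n^'m \<Rightarrow> complex^'m \<Rightarrow> 'm \<Rightarrow> complex^'n \<Rightarrow> complex^'n" where
  "rk_step A c i x =
     x + ((c $ i - (A *v x) $ i) / of_real ((norm (A $ i))\<^sup>2)) *s (\<chi> j. cnj (A $ i $ j))"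

definition z_step :: "complex^'n^'m \<Rightarrow> 'n \<Rightarrow> complex^'m \<Rightarrow> complex^'m" where
  "z_step A j z =
     z - ((\<Sum>i\<in>UNIV. cnj (column j A $ i) * z $ i) / of_real ((norm (column j A))\<^sup>2)) *s column j A"

text \<open>
  \<open>rk_rk U V y t\<close> is the joint law of \<open>(x\<^sub>t, b\<^sub>t)\<close>, and \<open>rek_rk U V y t\<close> that of
  \<open>(z\<^sub>t, x\<^sub>t, b\<^sub>t)\<close>. Every index is drawn afresh from a distribution that does not depend on the
  current state, so all index choices are independent.
\<close>

primrec rk_rk :: "complex^'k^'m \<Rightarrow> complex^'n^'k \<Rightarrow> complex^'m \<Rightarrow> nat \<Rightarrow>
    ((complex^'k) \<times> (complex^'n)) pmf" where
  "rk_rk U V y 0 = return_pmf (0, 0)"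
| "rk_rk U V y (Suc t) =
     do {
       (x, b) \<leftarrow> rk_rk U V y t;
       i \<leftarrow> row_pmf U;
       let x' = rk_step U y i x;
       p \<leftarrow> row_pmf V;
       let b' = rk_step V x' p b;
       return_pmf (x', b')
     }"

primrec rek_rk :: "complex^'k^'m \<Rightarrow> complex^'n^'k \<Rightarrow> complex^'m \<Rightarrow> nat \<Rightarrow>
    ((complex^'m) \<times> (complex^'k) \<times> (complex^'n)) pmf" where
  "rek_rk U V y 0 = return_pmf (y, 0, 0)"
| "rek_rk U V y (Suc t) =
     do {
       (z, x, b) \<leftarrow> rek_rk U V y t;
       i \<leftarrow> row_pmf U;
       j \<leftarrow> col_pmf U;
       let z' = z_step U j z;
       let x' = rk_step U (y - z') i x;
       p \<leftarrow> row_pmf V;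
       let b' = rk_step V x' p b;
       return_pmf (z', x', b')
     }"

text \<open>
  The laws have finite support, so these expectations are genuine.
\<close>

definition rk_rk_err :: "complex^'k^'m \<Rightarrow> complex^'n^'k \<Rightarrow> complex^'m \<Rightarrow> nat \<Rightarrow> complex^'n \<Rightarrow> real" where
  "rk_rk_err U V y t \<beta> =
     measure_pmf.expectation (rk_rk U V y t) (\<lambda>(x, b). (norm (b - \<beta>))\<^sup>2)"

definition rek_rk_err :: "complex^'k^'m \<Rightarrow> complex^'n^'k \<Rightarrow> complex^'m \<Rightarrow> nat \<Rightarrow> complex^'n \<Rightarrow> real" where
  "rek_rk_err U V y t \<beta> =
     measure_pmf.expectation (rek_rk U V y t) (\<lambda>(z, x, b). (norm (b - \<beta>))\<^sup>2)"

end

theory Submission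
  imports Defs
begin

text \<open>
  Adjoints and orthogonality are taken with respect to the real inner product \<open>Re \<langle>x, y\<rangle>\<close>.
  A Kaczmarz step splits orthogonally: \<open>\<parallel>x' - x\<^sub>0\<parallel>\<^sup>2\<close> equals \<open>\<parallel>x - x\<^sub>0\<parallel>\<^sup>2\<close> minus the squared
  \<open>i\<close>-th entry of \<open>A (x - x\<^sub>0)\<close> plus the squared \<open>i\<close>-th entry of \<open>c - A x\<^sub>0\<close>, both divided by
  \<open>\<parallel>A\<^sup>i\<parallel>\<^sup>2\<close>. Averaging cancels the row norms, so on the row space of \<open>A\<close> the expected error contracts
  by \<open>\<alpha>\<^sub>A\<close> up to the additive term \<open>\<parallel>c - A x\<^sub>0\<parallel>\<^sup>2 / \<parallel>A\<parallel>\<^sub>F\<^sup>2\<close>. In the outer system this term is the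
  error of the inner iterate, which decays geometrically; the resulting scalar recurrence
  \<open>d\<^sub>t\<^sub>+\<^sub>1 \<le> \<alpha>\<^sub>V d\<^sub>t + C q\<^sup>t\<close> has \<open>q = \<alpha>\<^sub>U\<close> for RK-RK and \<open>q = \<surd>\<alpha>\<^sub>U\<close> for REK-RK.
\<close>

section \<open>The conjugate transpose as an adjoint\<close>

lemma inner_conj_transpose:
  fixes A :: "complex^'n^'m"
  shows "(A *v x) \<bullet> y = x \<bullet> (conj_transpose A *v y)"
proof -
  have "(A *v x) \<bullet> y = (\<Sum>i\<in>UNIV. \<Sum>j\<in>UNIV. (A$i$j * x$j) \<bullet> y$i)"
    by (simp add: inner_vec_def matrix_vector_mult_def inner_sum_left)
  also have "\<dots> = (\<Sum>j\<in>UNIV. \<Sum>i\<in>UNIV. x$j \<bullet> (cnj (A$i$j) * y$i))"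
    by (subst sum.swap) (simp add: inner_complex_def algebra_simps)
  also have "\<dots> = x \<bullet> (conj_transpose A *v y)"
    by (simp add: inner_vec_def matrix_vector_mult_def inner_sum_right conj_transpose_def)
  finally show ?thesis .
qed

lemma conj_transpose_conj_transpose [simp]: "conj_transpose (conj_transpose A) = A"
  by (simp add: conj_transpose_def vec_eq_iff)

lemma inner_conj_transpose':
  "(conj_transpose A *v x) \<bullet> y = x \<bullet> (A *v y)"
  using inner_conj_transpose[of "conj_transpose A" x y] by simp

lemma norm_mult_vec_sq: "(norm (A *v x))\<^sup>2 = (conj_transpose A *v (A *v x)) \<bullet> x"
  by (simp add: power2_norm_eq_inner inner_conj_transpose')

text \<open>Pairing the hypothesis with \<open>x\<close> gives
  \<open>(norm (A *v x))\<^sup>2\<close>, so passing to the Gram matrix creates no new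
  kernel.\<close>

lemma conj_transpose_mult_eq_0D:
  assumes "conj_transpose A *v (A *v x) = 0"
  shows "A *v x = 0"
  using norm_mult_vec_sq[of A x] assms by simp

lemma frob_norm_conj_transpose [simp]: "frob_norm (conj_transpose A) = frob_norm A"
  unfolding frob_norm_def conj_transpose_def by (simp, rule sum.swap)

lemma conj_transpose_eq_0_iff [simp]: "conj_transpose A = 0 \<longleftrightarrow> A = 0"
  by (auto simp flip: frob_norm_eq_0_iff)

lemma range_conj_transpose_nontrivial:
  assumes "A \<noteq> 0"
  shows "range ((*v) (conj_transpose A)) \<noteq> {0}"
proof
  assume "range ((*v) (conj_transpose A)) = {0}"
  then have "conj_transpose A = 0" by (auto simp: matrix_eq)
  with assms show False by simp
qed

lemma subspace_range_mult_vec: "subspace (range ((*v) (A :: complex^'n^'m)))"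
  by (intro linear_subspace_image subspace_UNIV matrix_vector_mul_linear)

text \<open>The Gram eigenvalue attached to a singular value is real, so its complex eigenvector
  equation can be read with real scaling, as the real inner product requires.\<close>

lemma of_real_vector_mult: "of_real r *s (v :: complex^'n) = r *\<^sub>R v"
  by (simp add: vec_eq_iff scaleR_conv_of_real[where 'a=complex])

section \<open>Singular values\<close>

text \<open>Compactness yields a minimiser \<open>w\<close> of the quadratic form on the unit sphere
  of \<open>S\<close>. Its residual \<open>h = T w - l *\<^sub>R w\<close> stays in \<open>S\<close>
  by invariance, so \<open>w\<close> may be varied along \<open>h\<close>, and minimality forces
  \<open>h = 0\<close>.\<close>

lemma selfadjoint_min_eigenvector:
  fixes T :: "'a::euclidean_space \<Rightarrow> 'a"
  assumes T: "linear T" and sym: "\<And>x y. T x \<bullet> y = x \<bullet> T y"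
    and S: "subspace S" and inv: "\<And>x. x \<in> S \<Longrightarrow> T x \<in> S" and ne: "S \<noteq> {0}"
  obtains w l where "w \<in> S" "w \<noteq> 0" "T w = l *\<^sub>R w" "\<And>v. v \<in> S \<Longrightarrow> l * (norm v)\<^sup>2 \<le> T v \<bullet> v"
proof -
  let ?K = "S \<inter> sphere 0 1"
  have "compact ?K"
    using closed_subspace[OF S] by (intro closed_Int_compact compact_sphere)
  moreover obtain u where u: "u \<in> S" "u \<noteq> 0"
    using ne subspace_0[OF S] by auto
  then have "u /\<^sub>R norm u \<in> ?K"
    using S by (auto intro: subspace_scale)
  then have "?K \<noteq> {}" by blast
  moreover have "continuous_on ?K (\<lambda>v. T v \<bullet> v)"
    by (intro continuous_intros linear_continuous_on linear_conv_bounded_linear[THEN iffD1] T)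
  ultimately obtain w where w: "w \<in> ?K" and wmin: "\<And>v. v \<in> ?K \<Longrightarrow> T w \<bullet> w \<le> T v \<bullet> v"
    by (meson continuous_attains_inf)
  define l where "l = T w \<bullet> w"
  have low: "l * (norm v)\<^sup>2 \<le> T v \<bullet> v" if "v \<in> S" for v
  proof (cases "v = 0")
    case False
    have "v /\<^sub>R norm v \<in> ?K"
      using S that False by (auto intro: subspace_scale)
    from wmin[OF this] have "l \<le> (T v \<bullet> v) / (norm v)\<^sup>2"
      by (simp add: l_def linear_cmul[OF T] power2_eq_square divide_inverse mult_ac)
    then show ?thesis
      using False by (simp add: field_simps)
  qed (simp add: linear_0[OF T])
  define h where "h = T w - l *\<^sub>R w"
  have wS: "w \<in> S" and nw: "norm w = 1" using w by auto
  have hS: "h \<in> S" unfolding h_def using S inv wS by (intro subspace_diff subspace_scale)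
  define c where "c = T h \<bullet> h - l * (h \<bullet> h)"
  \<comment> \<open>Expansion of the form at \<open>w + t *\<^sub>R h\<close>: the constant term
    vanishes by the choice of \<open>l\<close>, and the linear coefficient is twice
    \<open>(norm h)\<^sup>2\<close>.\<close>
  have quad: "0 \<le> 2 * t * (norm h)\<^sup>2 + t\<^sup>2 * c" for t
  proof -
    have "w + t *\<^sub>R h \<in> S" using S wS hS by (intro subspace_add subspace_scale)
    from low[OF this] have "0 \<le> T (w + t *\<^sub>R h) \<bullet> (w + t *\<^sub>R h) - l * ((w + t *\<^sub>R h) \<bullet> (w + t *\<^sub>R h))"
      by (simp add: power2_norm_eq_inner)
    also have "\<dots> = (T w \<bullet> w - l * (w \<bullet> w)) + 2 * t * (T w \<bullet> h - l * (w \<bullet> h)) + t\<^sup>2 * c"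
      using sym[of h w]
      by (simp add: linear_add[OF T] linear_cmul[OF T] inner_simps c_def
          inner_commute[of h w] inner_commute[of "T w" h] power2_eq_square algebra_simps)
    also have "T w \<bullet> w - l * (w \<bullet> w) = 0"
      using nw by (simp add: l_def flip: power2_norm_eq_inner)
    also have "T w \<bullet> h - l * (w \<bullet> h) = (norm h)\<^sup>2"
      by (simp add: power2_norm_eq_inner h_def inner_simps inner_commute[of w "T w"])
    finally show ?thesis by simp
  qed
  have "norm h = 0"
  proof (rule ccontr)
    assume h: "norm h \<noteq> 0"
    \<comment> \<open>Negative, and small enough that \<open>t * c\<close> cannot outweigh
      \<open>2 * (norm h)\<^sup>2\<close>; the right-hand side of \<open>quad\<close> would then be
      negative.\<close>
    define t where "t = - (norm h)\<^sup>2 / (\<bar>c\<bar> + 1)"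
    have tneg: "t < 0" using h by (simp add: t_def divide_neg_pos)
    have "0 \<le> t * (2 * (norm h)\<^sup>2 + t * c)"
      using quad[of t] by (simp add: algebra_simps power2_eq_square)
    then have "2 * (norm h)\<^sup>2 + t * c \<le> 0"
      using tneg by (simp add: zero_le_mult_iff)
    moreover have "\<bar>t * c\<bar> \<le> (norm h)\<^sup>2"
    proof -
      have "\<bar>t * c\<bar> = (norm h)\<^sup>2 * (\<bar>c\<bar> / (\<bar>c\<bar> + 1))" by (simp add: t_def abs_mult)
      also have "\<dots> \<le> (norm h)\<^sup>2 * 1" by (intro mult_left_mono) auto
      finally show ?thesis by simp
    qed
    moreover have "(norm h)\<^sup>2 > 0" using h by simp
    ultimately show False by linarith
  qed
  then have "T w = l *\<^sub>R w" by (simp add: h_def)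
  with wS nw low show thesis by (intro that[of w l]) auto
qed

lemma linear_gram: "linear (\<lambda>x. conj_transpose A *v (A *v x))"
  using matrix_vector_mul_linear[of "conj_transpose A ** A"] by (simp add: matrix_vector_mul_assoc)

lemma singular_valuesI:
  assumes "conj_transpose A *v (A *v w) = (s\<^sup>2) *\<^sub>R w" "w \<noteq> 0" "0 \<le> s"
  shows "s \<in> singular_values A"
  using assms unfolding singular_values_def of_real_vector_mult
  by (auto simp flip: matrix_vector_mul_assoc)

text \<open>Gram eigenvectors for distinct eigenvalues are orthogonal, so choosing one per singular
  value gives an independent family, finite by dimension. Finiteness is what makes the
  \<open>Min\<close> and \<open>Max\<close> in \<open>sigma_min\<close> and \<open>sigma_max\<close>
  meaningful.\<close>

lemma finite_singular_values: "finite (singular_values (A :: complex^'n^'m))"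
proof -
  let ?T = "\<lambda>x. conj_transpose A *v (A *v x)"
  have "\<exists>v. v \<noteq> 0 \<and> ?T v = (s\<^sup>2) *\<^sub>R v" if "s \<in> singular_values A" for s
    using that unfolding singular_values_def of_real_vector_mult matrix_vector_mul_assoc by blast
  then obtain v where v0: "\<And>s. s \<in> singular_values A \<Longrightarrow> v s \<noteq> 0"
    and v: "\<And>s. s \<in> singular_values A \<Longrightarrow> ?T (v s) = (s\<^sup>2) *\<^sub>R v s"
    by metis
  have orth: "v s \<bullet> v s' = 0"
    if "s \<in> singular_values A" "s' \<in> singular_values A" "s \<noteq> s'" for s s'
  proof -
    have "?T (v s) \<bullet> v s' = v s \<bullet> ?T (v s')"
      by (simp add: inner_conj_transpose inner_conj_transpose')
    then have "s\<^sup>2 * (v s \<bullet> v s') = s'\<^sup>2 * (v s \<bullet> v s')"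
      by (simp add: v that)
    moreover have "s\<^sup>2 \<noteq> s'\<^sup>2"
      using that by (auto simp: singular_values_def power2_eq_iff_nonneg)
    ultimately show ?thesis by simp
  qed
  have inj: "inj_on v (singular_values A)"
  proof (rule inj_onI)
    fix s s' assume "s \<in> singular_values A" "s' \<in> singular_values A" "v s = v s'"
    then show "s = s'" using orth[of s s'] v0[of s'] by auto
  qed
  have "independent (v ` singular_values A)"
  proof (rule pairwise_orthogonal_independent)
    show "pairwise orthogonal (v ` singular_values A)"
      unfolding pairwise_image by (simp add: pairwise_def orthogonal_def orth)
    show "0 \<notin> v ` singular_values A" using v0 by force
  qed
  then have "finite (v ` singular_values A)" by (rule finiteI_independent)
  then show ?thesis using inj by (rule finite_imageD)
qed

lemma sigma_min_le_mult_vec: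
  fixes A :: "complex^'n^'m"
  assumes "A \<noteq> 0"
  shows sigma_min_pos: "0 < sigma_min A"
    and sigma_min_le: "w \<in> range ((*v) (conj_transpose A)) \<Longrightarrow>
      (sigma_min A)\<^sup>2 * (norm w)\<^sup>2 \<le> (norm (A *v w))\<^sup>2"
proof -
  let ?S = "range ((*v) (conj_transpose A))"
  let ?T = "\<lambda>x. conj_transpose A *v (A *v x)"
  obtain u l where u: "u \<in> ?S" "u \<noteq> 0" "?T u = l *\<^sub>R u"
    and low: "\<And>v. v \<in> ?S \<Longrightarrow> l * (norm v)\<^sup>2 \<le> ?T v \<bullet> v"
    using range_conj_transpose_nontrivial[OF assms]
    by (rule selfadjoint_min_eigenvector[OF linear_gram _ subspace_range_mult_vec, rotated 2])
      (auto simp: inner_conj_transpose inner_conj_transpose')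
  have "A *v u \<noteq> 0"
    using conj_transpose_mult_eq_0D[of "conj_transpose A"] u(1,2) by auto
  moreover have "(norm (A *v u))\<^sup>2 = l * (norm u)\<^sup>2"
    unfolding norm_mult_vec_sq u(3) by (simp add: power2_norm_eq_inner)
  ultimately have l: "l > 0"
    using u(2) by (metis norm_eq_zero zero_less_norm_iff zero_less_mult_pos2 zero_less_power)
  then have sv: "sqrt l \<in> {s \<in> singular_values A. s \<noteq> 0}"
    using u by (auto intro!: singular_valuesI[of A u])
  have fin: "finite {s \<in> singular_values A. s \<noteq> 0}"
    by (rule finite_subset[OF _ finite_singular_values[of A]]) blast
  have "sigma_min A \<in> {s \<in> singular_values A. s \<noteq> 0}"
    unfolding sigma_min_def using fin sv by (intro Min_in) auto
  then show pos: "0 < sigma_min A" by (auto simp: singular_values_def)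
  have "sigma_min A \<le> sqrt l"
    unfolding sigma_min_def using fin sv by (intro Min_le)
  then have "(sigma_min A)\<^sup>2 \<le> l"
    using pos l by (metis less_eq_real_def real_sqrt_pow2 power_mono)
  then show "(sigma_min A)\<^sup>2 * (norm w)\<^sup>2 \<le> (norm (A *v w))\<^sup>2"
    if "w \<in> ?S"
    using low[OF that] mult_right_mono[of "(sigma_min A)\<^sup>2" l "(norm w)\<^sup>2"] \<open>(sigma_min A)\<^sup>2 \<le> l\<close>
    by (simp add: norm_mult_vec_sq[of A w])
qed

text \<open>The minimum principle for the negated Gram map on the whole space: its least eigenvalue
  \<open>l\<close> makes \<open>- l\<close> the largest Gram eigenvalue.\<close>

lemma mult_vec_le_sigma_max:
  fixes A :: "complex^'n^'m"
  shows "(norm (A *v w))\<^sup>2 \<le> (sigma_max A)\<^sup>2 * (norm w)\<^sup>2"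
proof -
  let ?T = "\<lambda>x. - (conj_transpose A *v (A *v x))"
  have "axis undefined 1 \<noteq> (0 :: complex^'n)" by simp
  then have ne: "(UNIV :: (complex^'n) set) \<noteq> {0}" by blast
  have lin: "linear ?T"
    by (intro linear_compose_neg linear_gram)
  obtain u l where "u \<in> UNIV" and u: "u \<noteq> 0" "?T u = l *\<^sub>R u"
    and "\<And>v. v \<in> UNIV \<Longrightarrow> l * (norm v)\<^sup>2 \<le> ?T v \<bullet> v"
  proof (rule selfadjoint_min_eigenvector[OF lin _ subspace_UNIV _ ne])
    show "?T x \<bullet> y = x \<bullet> ?T y" for x y
      by (simp add: inner_conj_transpose inner_conj_transpose')
  qed simp_all
  then have low: "l * (norm v)\<^sup>2 \<le> ?T v \<bullet> v" for v by simp
  have up: "(norm (A *v v))\<^sup>2 \<le> - l * (norm v)\<^sup>2" for v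
    using low[of v] by (simp add: norm_mult_vec_sq)
  have l: "0 \<le> - l"
  proof -
    have "0 \<le> - l * (norm u)\<^sup>2" using up[of u] zero_le_power2 order_trans by blast
    then show ?thesis using u(1) by (simp add: mult_le_0_iff)
  qed
  have "conj_transpose A *v (A *v u) = (- l) *\<^sub>R u"
    using u(2) by (simp add: neg_eq_iff_add_eq_0 minus_equation_iff[of _ "l *\<^sub>R u"] eq_commute)
  then have sv: "sqrt (- l) \<in> singular_values A"
    using u l by (intro singular_valuesI[of A u]) auto
  have "sqrt (- l) \<le> sigma_max A"
    unfolding sigma_max_def using finite_singular_values sv by (rule Max_ge)
  then have "- l \<le> (sigma_max A)\<^sup>2"
    using l by (simp add: sqrt_le_D)
  then show ?thesis
    using up[of w] mult_right_mono[of "- l" "(sigma_max A)\<^sup>2" "(norm w)\<^sup>2"] by simp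
qed

section \<open>Full-rank matrices and optimal solutions\<close>

lemma full_rank_imp_inj:
  fixes A :: "complex^'n^'m"
  assumes "full_rank A" "CARD('n) \<le> CARD('m)"
  shows "inj ((*v) A)"
proof -
  have "vec.dim (rows A) = vec.dimension TYPE(complex) TYPE('n)"
    using assms by (simp add: full_rank_def row_rank_def_gen vec.dimension_def card_cart_basis)
  then have "vec.span (rows A) = UNIV"
    by (simp add: vec.dim_eq_full)
  then show ?thesis
    by (simp flip: matrix_left_invertible_span_rows_gen matrix_left_invertible_injective)
qed

text \<open>Full row rank makes the rows linearly independent, which is equivalent to a right
  inverse.\<close>

lemma full_rank_imp_surj:
  fixes A :: "complex^'n^'m"
  assumes "full_rank A" "CARD('m) \<le> CARD('n)"
  shows "surj ((*v) A)"
proof -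
  have rows: "rows A = range (\<lambda>i. row i A)" by (auto simp: rows_def)
  have dim: "vec.dim (rows A) = CARD('m)"
    using assms by (simp add: full_rank_def row_rank_def_gen)
  have fin: "finite (rows A)" by (simp add: rows)
  have card: "card (rows A) \<le> CARD('m)" unfolding rows by (rule card_image_le) simp
  have ind: "vec.independent (rows A)"
    using card dim fin vec.card_le_dim_spanning[of "rows A" "rows A"]
    by (simp add: vec.span_superset)
  then have "card (rows A) = CARD('m)"
    using dim by (simp add: vec.dim_eq_card_independent)
  \<comment> \<open>\<open>rows A\<close> is a set and would hide repeated rows. The cardinality
    count excludes repetitions, so independence of the set passes to the indexed family.\<close>
  then have inj: "inj (\<lambda>i. row i A)"
    unfolding rows by (intro eq_card_imp_inj_on) auto
  have "c i = 0" if "(\<Sum>i\<in>UNIV. c i *s row i A) = 0" for c i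
  proof -
    define u where "u r = c (inv (\<lambda>i. row i A) r)" for r
    have "(\<Sum>r\<in>rows A. u r *s r) = 0"
      unfolding rows using that by (simp add: sum.reindex[OF inj] u_def inv_f_f[OF inj])
    then have "u (row i A) = 0"
      using ind fin vec.independentD[of "rows A" "rows A" u "row i A"] by (auto simp: rows)
    then show ?thesis by (simp add: u_def inv_f_f[OF inj])
  qed
  then show ?thesis
    by (simp flip: matrix_right_invertible_surjective add: matrix_right_invertible_independent_rows)
qed

text \<open>A trivial kernel gives a left inverse, which for a square matrix is two-sided; hence the
  choice in \<open>matrix_inv\<close> has a witness.\<close>

lemma matrix_inv_solves:
  fixes G :: "complex^'n^'n"
  assumes "\<And>x. G *v x = 0 \<Longrightarrow> x = 0"
  shows "G *v (matrix_inv G *v x) = x"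
proof -
  have "\<exists>B. B ** G = mat 1"
    using assms by (simp add: matrix_left_invertible_ker)
  then have "\<exists>B. G ** B = mat 1 \<and> B ** G = mat 1"
    using matrix_left_right_inverse by blast
  then have "G ** matrix_inv G = mat 1"
    unfolding matrix_inv_def by (rule someI2_ex) simp
  then show ?thesis by (simp add: matrix_vector_mul_assoc)
qed

lemma normal_equation_x_opt:
  assumes "inj ((*v) U)"
  shows "conj_transpose U *v (U *v x_opt U y) = conj_transpose U *v y"
proof -
  have "(conj_transpose U ** U) *v x_opt U y = conj_transpose U *v y"
    unfolding x_opt_def
    using conj_transpose_mult_eq_0D[of U] assms
    by (intro matrix_inv_solves) (auto simp: vec.inj_iff_eq_0 simp flip: matrix_vector_mul_assoc)
  then show ?thesis by (simp add: matrix_vector_mul_assoc)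
qed

lemma conj_transpose_inj_of_surj:
  assumes "surj ((*v) V)" "conj_transpose V *v u = 0"
  shows "u = 0"
proof -
  obtain w where "u = V *v w" using assms(1) by blast
  then have "u \<bullet> u = (conj_transpose V *v u) \<bullet> w"
    by (simp add: inner_conj_transpose')
  then show ?thesis using assms(2) by simp
qed

lemma mult_b_opt:
  assumes "surj ((*v) V)"
  shows "V *v b_opt V x = x"
proof -
  have "(V ** conj_transpose V) *v (matrix_inv (V ** conj_transpose V) *v x) = x"
    using conj_transpose_mult_eq_0D[of "conj_transpose V"] conj_transpose_inj_of_surj[OF assms]
    by (intro matrix_inv_solves) (simp flip: matrix_vector_mul_assoc)
  then show ?thesis by (simp add: b_opt_def flip: matrix_vector_mul_assoc)
qed

text \<open>The adjoint has the right inverse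
  \<open>U ** matrix_inv (conj_transpose U ** U)\<close>. Consequently every error of the inner
  iterate lies in the row space of \<open>U\<close>.\<close>

lemma range_conj_transpose_UNIV:
  assumes "inj ((*v) U)"
  shows "range ((*v) (conj_transpose U)) = UNIV"
proof -
  have "conj_transpose U *v (U *v (matrix_inv (conj_transpose U ** U) *v x)) = x" for x
    using conj_transpose_mult_eq_0D[of U] assms matrix_inv_solves[of "conj_transpose U ** U" x]
    by (auto simp: vec.inj_iff_eq_0 simp flip: matrix_vector_mul_assoc)
  then show ?thesis by (metis surj_def)
qed

text \<open>For \<open>w = A *v v\<close>, Cauchy-Schwarz bounds \<open>(norm w)\<^sup>2\<close> by
  \<open>norm v * norm (conj_transpose A *v w)\<close>, and \<open>sigma_min A * norm v\<close> is
  at most \<open>norm w\<close>. This gives the adjoint the same constant without comparing the two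
  sets of singular values.\<close>

lemma sigma_min_le_conj_transpose:
  fixes A :: "complex^'n^'m"
  assumes "A \<noteq> 0" "inj ((*v) A)" "w \<in> range ((*v) A)"
  shows "(sigma_min A)\<^sup>2 * (norm w)\<^sup>2 \<le> (norm (conj_transpose A *v w))\<^sup>2"
proof -
  let ?s = "sigma_min A" and ?r = "norm (conj_transpose A *v w)"
  have s: "0 < ?s" using assms(1) by (rule sigma_min_pos)
  obtain v where v: "w = A *v v" using assms(3) by blast
  have "(?s * norm v)\<^sup>2 \<le> (norm w)\<^sup>2"
    using sigma_min_le[OF assms(1), of v] range_conj_transpose_UNIV[OF assms(2)]
    by (simp add: v power_mult_distrib)
  then have sv: "?s * norm v \<le> norm w"
    by (rule power2_le_imp_le) simp
  have "(norm w)\<^sup>2 = v \<bullet> (conj_transpose A *v w)"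
    by (simp add: power2_norm_eq_inner v inner_conj_transpose)
  also have "\<dots> \<le> norm v * ?r" by (rule norm_cauchy_schwarz)
  finally have "?s * (norm w)\<^sup>2 \<le> (?s * norm v) * ?r"
    using s by (simp add: mult.assoc)
  also have "\<dots> \<le> norm w * ?r" using sv by (rule mult_right_mono) simp
  finally have "norm w * (?s * norm w) \<le> norm w * ?r"
    by (simp add: power2_eq_square mult_ac)
  then have "?s * norm w \<le> ?r"
    by (cases "w = 0") auto
  then have "(?s * norm w)\<^sup>2 \<le> ?r\<^sup>2"
    using s by (intro power_mono) auto
  then show ?thesis by (simp add: power_mult_distrib)
qed

text \<open>Pythagoras twice. The residual of \<open>x_opt\<close> is orthogonal to the range of
  \<open>U\<close>, so the least-squares solutions of the product are exactly the solutions of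
  \<open>V *v b = x_opt U y\<close>. Among these, \<open>b_opt\<close> lies in the row space of
  \<open>V\<close>, orthogonal to all differences of solutions, and so has least norm.\<close>

lemma min_norm_lsq_factorization:
  fixes U :: "complex^'k^'m" and V :: "complex^'n^'k"
  assumes U: "inj ((*v) U)" and V: "surj ((*v) V)"
  shows "min_norm_lsq (U ** V) y = b_opt V (x_opt U y)"
proof -
  define x where "x = x_opt U y"
  define b where "b = b_opt V x"
  have b: "V *v b = x" by (simp add: b_def mult_b_opt[OF V])
  have pyth: "(norm (U *v w - y))\<^sup>2 = (norm (U *v (w - x)))\<^sup>2 + (norm (U *v x - y))\<^sup>2" for w
  proof -
    have "(U *v (w - x)) \<bullet> (U *v x - y) = 0"
      using normal_equation_x_opt[OF U, of y]
      by (simp only: inner_conj_transpose) (simp add: matrix_vector_mult_diff_distrib x_def)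
    moreover have "U *v w - y = U *v (w - x) + (U *v x - y)"
      by (simp add: matrix_vector_mult_diff_distrib)
    ultimately show ?thesis
      by (simp only: norm_add_Pythagorean[unfolded orthogonal_def])
  qed
  have lsq: "is_lsq (U ** V) y \<beta> \<longleftrightarrow> V *v \<beta> = x" for \<beta>
  proof
    assume "is_lsq (U ** V) y \<beta>"
    then have "norm (U *v (V *v \<beta>) - y) \<le> norm (U *v (V *v b) - y)"
      unfolding is_lsq_def by (simp flip: matrix_vector_mul_assoc)
    then have "(norm (U *v (V *v \<beta>) - y))\<^sup>2 \<le> (norm (U *v x - y))\<^sup>2"
      by (simp add: b)
    then have "(norm (U *v (V *v \<beta> - x)))\<^sup>2 \<le> 0"
      using pyth[of "V *v \<beta>"] by linarith
    then have "U *v (V *v \<beta> - x) = 0" by simp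
    then have "V *v \<beta> - x = 0"
      using U vec.inj_iff_eq_0[of U] by blast
    then show "V *v \<beta> = x" by simp
  next
    assume x: "V *v \<beta> = x"
    have "norm (U *v (V *v \<beta>) - y) \<le> norm (U *v w - y)" for w
    proof (rule power2_le_imp_le)
      show "(norm (U *v (V *v \<beta>) - y))\<^sup>2 \<le> (norm (U *v w - y))\<^sup>2"
        unfolding x pyth[of w] by simp
    qed simp
    then show "is_lsq (U ** V) y \<beta>"
      unfolding is_lsq_def by (simp flip: matrix_vector_mul_assoc)
  qed
  have pyth_b: "(norm \<beta>)\<^sup>2 = (norm (\<beta> - b))\<^sup>2 + (norm b)\<^sup>2" if "V *v \<beta> = x" for \<beta>
  proof -
    have "(\<beta> - b) \<bullet> b = 0"
      using that b unfolding b_def b_opt_def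
      by (simp add: matrix_vector_mult_diff_distrib flip: inner_conj_transpose)
    then show ?thesis
      using norm_add_Pythagorean[of "\<beta> - b" b] by (simp add: orthogonal_def)
  qed
  have "(THE \<beta>. is_lsq (U ** V) y \<beta> \<and> (\<forall>\<beta>'. is_lsq (U ** V) y \<beta>' \<longrightarrow> norm \<beta> \<le> norm \<beta>')) = b"
  proof (rule the_equality)
    show "is_lsq (U ** V) y b \<and> (\<forall>\<beta>'. is_lsq (U ** V) y \<beta>' \<longrightarrow> norm b \<le> norm \<beta>')"
    proof (intro conjI allI impI)
      show "is_lsq (U ** V) y b" using b by (simp add: lsq)
      fix \<beta>' assume "is_lsq (U ** V) y \<beta>'"
      then have "(norm b)\<^sup>2 \<le> (norm \<beta>')\<^sup>2"
        using pyth_b[of \<beta>'] by (simp add: lsq)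
      then show "norm b \<le> norm \<beta>'" by (rule power2_le_imp_le) simp
    qed
  next
    fix \<beta> assume "is_lsq (U ** V) y \<beta> \<and> (\<forall>\<beta>'. is_lsq (U ** V) y \<beta>' \<longrightarrow> norm \<beta> \<le> norm \<beta>')"
    then have "V *v \<beta> = x" "norm \<beta> \<le> norm b" by (auto simp: lsq b)
    then have "(norm (\<beta> - b))\<^sup>2 \<le> 0"
      using pyth_b[of \<beta>] power_mono[of "norm \<beta>" "norm b" 2] by simp
    then show "\<beta> = b" by simp
  qed
  then show ?thesis by (simp add: min_norm_lsq_def b_def x_def)
qed

section \<open>One Kaczmarz step\<close>

lemma norm_rk_step:
  fixes A :: "complex^'n^'m"
  shows "(norm (rk_step A c i x - x0))\<^sup>2 = (norm (x - x0))\<^sup>2 +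
    ((cmod ((c - A *v x0) $ i))\<^sup>2 - (cmod ((A *v (x - x0)) $ i))\<^sup>2) / (norm (A $ i))\<^sup>2"
proof -
  define n where "n = (norm (A $ i))\<^sup>2"
  define g where "g = (A *v (x - x0)) $ i"
  define d where "d = (c - A *v x0) $ i"
  define a :: "complex^'n" where "a = (\<chi> j. cnj (A $ i $ j))"
  \<comment> \<open>The update coefficient rewritten relative to \<open>x0\<close>. A zero row gives
    \<open>n = 0\<close> and hence \<open>s = 0\<close>, so the identity covers that case
    too.\<close>
  define s where "s = (1 / n) *\<^sub>R (d - g)"
  have s: "(c $ i - (A *v x) $ i) / of_real n = s"
    by (simp add: s_def d_def g_def matrix_vector_mult_diff_distrib scaleR_conv_of_real divide_inverse)
  have step: "rk_step A c i x - x0 = (x - x0) + s *s a"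
    using s by (simp add: rk_step_def a_def n_def)
  have na: "norm (s *s a) ^ 2 = (cmod s)\<^sup>2 * n"
    unfolding norm_vec_sq n_def by (simp add: a_def norm_mult power_mult_distrib sum_distrib_left)
  have ip: "(x - x0) \<bullet> (s *s a) = g \<bullet> s"
  proof -
    have "(x - x0) \<bullet> (s *s a) = (\<Sum>j\<in>UNIV. (A $ i $ j * (x - x0) $ j) \<bullet> s)"
      unfolding inner_vec_def by (rule sum.cong) (simp_all add: a_def inner_complex_def algebra_simps)
    then show ?thesis
      by (simp add: g_def matrix_vector_mult_def inner_sum_left)
  qed
  have "(norm (rk_step A c i x - x0))\<^sup>2 = (norm (x - x0))\<^sup>2 + 2 * (g \<bullet> s) + (cmod s)\<^sup>2 * n"
    unfolding step na[symmetric] ip[symmetric]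
    by (simp add: power2_norm_eq_inner inner_add_left inner_add_right inner_commute)
  moreover have "2 * (g \<bullet> s) + (cmod s)\<^sup>2 * n = ((cmod d)\<^sup>2 - (cmod g)\<^sup>2) / n"
  proof -
    have "g \<bullet> s = (g \<bullet> d - g \<bullet> g) / n"
      by (simp add: s_def inner_diff_right)
    moreover have "(cmod s)\<^sup>2 * n = (cmod (d - g))\<^sup>2 / n"
      by (simp add: s_def power_divide power2_eq_square)
    moreover have "(cmod (d - g))\<^sup>2 = (cmod d)\<^sup>2 - 2 * (g \<bullet> d) + (cmod g)\<^sup>2"
      by (simp add: power2_norm_eq_inner inner_diff_left inner_diff_right inner_commute)
    ultimately show ?thesis
      by (simp add: power2_norm_eq_inner add_divide_distrib diff_divide_distrib)
  qed
  ultimately show ?thesis by (simp add: n_def d_def g_def)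
qed

lemma expectation_rk_step:
  fixes A :: "complex^'n^'m"
  assumes "A \<noteq> 0"
  shows "measure_pmf.expectation (row_pmf A) (\<lambda>i. (norm (rk_step A c i x - x0))\<^sup>2)
    \<le> (norm (x - x0))\<^sup>2 + ((norm (c - A *v x0))\<^sup>2 - (norm (A *v (x - x0)))\<^sup>2) / (frob_norm A)\<^sup>2"
proof -
  let ?F = "(frob_norm A)\<^sup>2" and ?n = "\<lambda>i. (norm (A $ i))\<^sup>2"
  let ?d = "\<lambda>i. (cmod ((c - A *v x0) $ i))\<^sup>2" and ?g = "\<lambda>i. (cmod ((A *v (x - x0)) $ i))\<^sup>2"
  have F: "?F > 0" using assms by (simp add: frob_norm_eq_0_iff)
  have "measure_pmf.expectation (row_pmf A) (\<lambda>i. (norm (rk_step A c i x - x0))\<^sup>2)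
      = (\<Sum>i\<in>UNIV. ?n i / ?F * ((norm (x - x0))\<^sup>2 + (?d i - ?g i) / ?n i))"
    by (subst integral_measure_pmf[of UNIV]) (simp_all add: pmf_row_pmf[OF assms] norm_rk_step)
  also have "\<dots> \<le> (\<Sum>i\<in>UNIV. ?n i / ?F * (norm (x - x0))\<^sup>2 + (?d i - ?g i) / ?F)"
  proof (rule sum_mono)
    fix i
    show "?n i / ?F * ((norm (x - x0))\<^sup>2 + (?d i - ?g i) / ?n i)
        \<le> ?n i / ?F * (norm (x - x0))\<^sup>2 + (?d i - ?g i) / ?F"
    proof (cases "A $ i = 0")
      \<comment> \<open>A zero row has probability 0, which removes its residual entry on the left
        but not on the right; this is the source of the inequality.\<close>
      case True
      then have "?g i = 0" by (simp add: matrix_vector_mult_def)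
      with True F show ?thesis by simp
    next
      case False
      with F show ?thesis by (simp add: field_simps)
    qed
  qed
  also have "\<dots> = (norm (x - x0))\<^sup>2 + ((norm (c - A *v x0))\<^sup>2 - (norm (A *v (x - x0)))\<^sup>2) / ?F"
    using F by (simp add: sum.distrib norm_vec_sq[of "c - A *v x0"] norm_vec_sq[of "A *v (x - x0)"]
        diff_divide_distrib sum_subtractf
        flip: sum_divide_distrib sum_distrib_right frob_norm_sq_rows)
  finally show ?thesis .
qed

lemma expectation_rk_step_contraction:
  fixes A :: "complex^'n^'m"
  assumes "A \<noteq> 0" "x - x0 \<in> range ((*v) (conj_transpose A))"
  shows "measure_pmf.expectation (row_pmf A) (\<lambda>i. (norm (rk_step A c i x - x0))\<^sup>2)
    \<le> alpha A * (norm (x - x0))\<^sup>2 + (norm (c - A *v x0))\<^sup>2 / (frob_norm A)\<^sup>2"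
proof -
  have "(sigma_min A)\<^sup>2 * (norm (x - x0))\<^sup>2 / (frob_norm A)\<^sup>2 \<le> (norm (A *v (x - x0)))\<^sup>2 / (frob_norm A)\<^sup>2"
    using sigma_min_le[OF assms] by (intro divide_right_mono) auto
  then show ?thesis
    using expectation_rk_step[OF assms(1), of c x x0]
    by (simp add: alpha_def diff_divide_distrib algebra_simps)
qed

lemma alpha_le_1: "alpha A \<le> 1"
  by (simp add: alpha_def)

text \<open>For the homogeneous system and a nonzero \<open>w\<close> in the row space, the
  contraction bounds a nonnegative expectation by \<open>alpha A * (norm w)\<^sup>2\<close>.\<close>

lemma alpha_nonneg:
  fixes A :: "complex^'n^'m"
  assumes "A \<noteq> 0"
  shows "0 \<le> alpha A"
proof -
  obtain w where w: "w \<in> range ((*v) (conj_transpose A))" "w \<noteq> 0"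
    using range_conj_transpose_nontrivial[OF assms] subspace_0[OF subspace_range_mult_vec[of "conj_transpose A"]]
    by blast
  have "0 \<le> measure_pmf.expectation (row_pmf A) (\<lambda>i. (norm (rk_step A 0 i w - 0))\<^sup>2)"
    by (intro Bochner_Integration.integral_nonneg) auto
  also have "\<dots> \<le> alpha A * (norm w)\<^sup>2"
    using expectation_rk_step_contraction[OF assms, of w 0 0] w by simp
  finally show ?thesis
    using w(2) by (simp add: zero_le_mult_iff)
qed

text \<open>The correction is a multiple of a conjugated row, that is, the adjoint applied to a
  scaled unit vector. Errors therefore never leave the subspace on which the contraction
  holds.\<close>

lemma rk_step_diff_in_range:
  assumes "x - x0 \<in> range ((*v) (conj_transpose A))"
  shows "rk_step A c i x - x0 \<in> range ((*v) (conj_transpose A))"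
proof -
  have "r *s (\<chi> j. cnj (A $ i $ j)) = conj_transpose A *v axis i r" for r
  proof -
    have "(\<Sum>k\<in>UNIV. cnj (A $ k $ j) * axis i r $ k) = (\<Sum>k\<in>UNIV. if k = i then r * cnj (A $ k $ j) else 0)" for j
      by (rule sum.cong) (auto simp: axis_def)
    then show ?thesis
      by (simp add: vec_eq_iff matrix_vector_mult_def conj_transpose_def)
  qed
  then show ?thesis
    unfolding rk_step_def diff_add_eq[symmetric]
    by (simp only: subspace_add[OF subspace_range_mult_vec assms] rangeI)
qed

section \<open>The projection iteration for the residual\<close>

lemma norm_conj_transpose_row: "norm (conj_transpose A $ j) = norm (column j A)"
proof -
  have "(norm (conj_transpose A $ j))\<^sup>2 = (norm (column j A))\<^sup>2"
    unfolding norm_vec_sq by (simp add: conj_transpose_def column_def)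
  then show ?thesis by simp
qed

text \<open>The \<open>z\<close>-iteration of REK is plain Kaczmarz for the homogeneous system \<open>U\<^sup>* z = 0\<close>.\<close>

lemma z_step_eq_rk_step: "z_step A j z = rk_step (conj_transpose A) 0 j z"
  unfolding z_step_def rk_step_def norm_conj_transpose_row
  by (simp add: vec_eq_iff matrix_vector_mult_def conj_transpose_def column_def)

lemma col_pmf_eq_row_pmf: "col_pmf A = row_pmf (conj_transpose A)"
  by (simp add: col_pmf_def row_pmf_def norm_conj_transpose_row)

text \<open>The target \<open>r\<close> solves the homogeneous adjoint system, so the additive term
  of the Kaczmarz estimate vanishes.\<close>

lemma expectation_z_step_contraction:
  fixes A :: "complex^'n^'m"
  assumes "A \<noteq> 0" "inj ((*v) A)" "z - r \<in> range ((*v) A)" "conj_transpose A *v r = 0"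
  shows "measure_pmf.expectation (col_pmf A) (\<lambda>j. (norm (z_step A j z - r))\<^sup>2)
    \<le> alpha A * (norm (z - r))\<^sup>2"
proof -
  have "(sigma_min A)\<^sup>2 * (norm (z - r))\<^sup>2 / (frob_norm A)\<^sup>2
      \<le> (norm (conj_transpose A *v (z - r)))\<^sup>2 / (frob_norm A)\<^sup>2"
    using sigma_min_le_conj_transpose[OF assms(1-3)] by (intro divide_right_mono) auto
  then show ?thesis
    using expectation_rk_step[of "conj_transpose A" 0 z r] assms(1,4)
    by (simp add: alpha_def algebra_simps z_step_eq_rk_step col_pmf_eq_row_pmf)
qed

section \<open>Scalar estimates\<close>

text \<open>Discrete variation of constants: the input of step \<open>i\<close> is damped by
  \<open>a\<close> in each of the \<open>t - 1 - i\<close> later steps.\<close>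

lemma linear_recurrence_le:
  fixes d :: "nat \<Rightarrow> real"
  assumes "\<And>t. d (Suc t) \<le> a * d t + C * q ^ t" "0 \<le> a"
  shows "d t \<le> a ^ t * d 0 + C * (\<Sum>i<t. a ^ (t - 1 - i) * q ^ i)"
proof (induction t)
  case (Suc t)
  have "(\<Sum>i<Suc t. a ^ (t - i) * q ^ i) = a * (\<Sum>i<t. a ^ (t - 1 - i) * q ^ i) + q ^ t"
  proof -
    have "a ^ (t - i) * q ^ i = a * (a ^ (t - 1 - i) * q ^ i)" if "i < t" for i
    proof -
      have "t - i = Suc (t - 1 - i)" using that by simp
      then show ?thesis by simp
    qed
    then show ?thesis by (auto simp: sum_distrib_left intro!: sum.cong simp del: diff_diff_left)
  qed
  moreover have "a * d t \<le> a * (a ^ t * d 0 + C * (\<Sum>i<t. a ^ (t - 1 - i) * q ^ i))"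
    using Suc assms(2) by (rule mult_left_mono)
  ultimately show ?case
    using assms(1)[of t] by (simp add: algebra_simps)
qed simp

text \<open>Factoring out the dominant power \<open>a ^ (t - 1)\<close> leaves a geometric sum with
  ratio \<open>b / a\<close>.\<close>

lemma mixed_power_sum_le_of_less:
  fixes a b :: real
  assumes "0 \<le> b" "b < a"
  shows "(\<Sum>i<t. a ^ (t - 1 - i) * b ^ i) \<le> inverse (1 - b / a) * a ^ (t - 1)"
proof -
  have r: "b / a < 1" "0 \<le> b / a" using assms by auto
  have "(\<Sum>i<t. a ^ (t - 1 - i) * b ^ i) = a ^ (t - 1) * (\<Sum>i<t. (b / a) ^ i)"
    unfolding sum_distrib_left
  proof (rule sum.cong)
    fix i assume "i \<in> {..<t}"
    then have "a ^ (t - 1) = a ^ (t - 1 - i) * a ^ i" by (simp flip: power_add)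
    then show "a ^ (t - 1 - i) * b ^ i = a ^ (t - 1) * (b / a) ^ i"
      using assms by (simp add: power_divide)
  qed simp
  also have "(\<Sum>i<t. (b / a) ^ i) = (1 - (b / a) ^ t) / (1 - b / a)"
    using assms by (simp add: sum_gp_strict)
  also have "\<dots> \<le> 1 / (1 - b / a)"
    using r by (intro divide_right_mono) auto
  finally show ?thesis
    using assms by (simp add: inverse_eq_divide mult.commute mult_left_mono)
qed

lemma mixed_power_sum_le:
  fixes a b :: real
  assumes "0 \<le> a" "0 \<le> b"
  shows "(\<Sum>i<t. a ^ (t - 1 - i) * b ^ i) \<le>
    (if b \<noteq> a then inverse (1 - min (b / a) (a / b)) else real t) * (max b a) ^ (t - 1)"
proof -
  consider "b < a" | "a < b" | "a = b" by linarith
  then show ?thesis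
  proof cases
    case 1
    \<comment> \<open>For \<open>b = 0\<close> the quotient \<open>a / b\<close> is 0 by convention,
      so the minimum is still \<open>b / a\<close>.\<close>
    then have "min (b / a) (a / b) = b / a"
      using assms by (cases "b = 0") (auto simp: min_def field_simps mult_mono)
    with 1 show ?thesis using mixed_power_sum_le_of_less[of b a t] assms by simp
  next
    case 2
    then have "min (b / a) (a / b) = a / b"
    proof (cases "a = 0")
      case False
      with 2 assms have "a / b \<le> 1" "1 \<le> b / a" by auto
      then show ?thesis by simp
    qed simp
    moreover have "(\<Sum>i<t. a ^ (t - 1 - i) * b ^ i) = (\<Sum>i<t. b ^ (t - 1 - i) * a ^ i)"
      by (subst sum.nat_diff_reindex[symmetric]) (auto intro!: sum.cong simp: mult.commute)
    ultimately show ?thesis using 2 mixed_power_sum_le_of_less[of a b t] assms by simp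
  next
    case 3
    have "(\<Sum>i<t. a ^ (t - 1 - i) * a ^ i) = (\<Sum>i<t. a ^ (t - 1))"
      by (rule sum.cong) (auto simp flip: power_add)
    with 3 show ?thesis by simp
  qed
qed

text \<open>The \<open>t\<close> copies of \<open>q ^ t\<close> are dominated by
  \<open>1, q, ..., q ^ (t - 1)\<close>, and the factor \<open>1 - q\<close> telescopes that
  geometric sum.\<close>

lemma mult_power_le_1:
  fixes q :: real
  assumes "0 \<le> q" "q \<le> 1"
  shows "(1 - q) * real t * q ^ t \<le> 1"
proof -
  have "real t * q ^ t = (\<Sum>i<t. q ^ t)" by simp
  also have "\<dots> \<le> (\<Sum>i<t. q ^ i)"
    using assms by (intro sum_mono power_decreasing) auto
  finally have "(1 - q) * (real t * q ^ t) \<le> (1 - q) * (\<Sum>i<t. q ^ i)"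
    using assms by (intro mult_left_mono) auto
  also have "\<dots> = 1 - q ^ t" by (simp add: one_diff_power_eq)
  also have "\<dots> \<le> 1" using assms by simp
  finally show ?thesis by (simp add: mult.assoc)
qed

text \<open>Square roots absorb the linear factor: \<open>t q\<^sup>t (1 - q\<^sup>2) \<le> 1 + q \<le> 2\<close> for \<open>q = \<surd>\<alpha>\<close>.\<close>

lemma power_linear_factor_le:
  fixes q k :: real
  assumes "0 \<le> q" "q \<le> 1" "0 \<le> k"
  shows "(q\<^sup>2) ^ Suc t * (1 + real (Suc t) * (k * (1 - q\<^sup>2))) \<le> q ^ t * (1 + 2 * k)"
proof -
  let ?s = "Suc t"
  \<comment> \<open>Half of the decay is kept as \<open>q ^ t\<close>; the remaining
    \<open>q ^ Suc t\<close> is spent on the linear factor.\<close>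
  have e: "(q\<^sup>2) ^ ?s = q ^ t * (q * q ^ ?s)"
    by (simp add: power2_eq_square power_mult_distrib)
  have "q * q ^ ?s * (1 + real ?s * (k * (1 - q\<^sup>2)))
      = q * q ^ ?s + k * (q * (1 + q)) * ((1 - q) * real ?s * q ^ ?s)"
    by (simp add: power2_eq_square algebra_simps del: of_nat_Suc)
  also have "\<dots> \<le> 1 + k * (q * (1 + q)) * 1"
  proof (intro add_mono mult_left_mono)
    show "q * q ^ ?s \<le> 1"
      using power_le_one[OF assms(1,2), of "Suc ?s"] by simp
  qed (use assms mult_power_le_1[OF assms(1,2), of ?s] in auto)
  also have "k * (q * (1 + q)) * 1 \<le> k * (1 * 2)"
    using assms unfolding mult_1_right by (intro mult_left_mono mult_mono) auto
  finally have "q * q ^ ?s * (1 + real ?s * (k * (1 - q\<^sup>2))) \<le> 1 + 2 * k" by simp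
  then show ?thesis
    unfolding e using assms by (simp add: mult.assoc mult_left_mono del: power_Suc of_nat_Suc)
qed

section \<open>Expectations along the iterations\<close>

lemma expectation_bind_finite:
  fixes h :: "'b \<Rightarrow> real"
  assumes "finite (set_pmf p)" "\<And>s. s \<in> set_pmf p \<Longrightarrow> finite (set_pmf (K s))"
  shows "measure_pmf.expectation (p \<bind> K) h
    = measure_pmf.expectation p (\<lambda>s. measure_pmf.expectation (K s) h)"
  using assms
  by (subst pmf_expectation_bind[of "set_pmf p"]) (auto simp: integral_measure_pmf[of "set_pmf p"])

lemma expectation_mono_finite:
  fixes g h :: "'a \<Rightarrow> real"
  assumes "finite (set_pmf p)" "\<And>s. s \<in> set_pmf p \<Longrightarrow> h s \<le> g s"
  shows "measure_pmf.expectation p h \<le> measure_pmf.expectation p g"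
  using assms by (intro integral_mono_AE) (auto simp: AE_measure_pmf_iff integrable_measure_pmf_finite)

lemma expectation_bind_le:
  fixes h :: "'b \<Rightarrow> real"
  assumes "finite (set_pmf p)" "\<And>s. s \<in> set_pmf p \<Longrightarrow> finite (set_pmf (K s))"
    and "\<And>s. s \<in> set_pmf p \<Longrightarrow> measure_pmf.expectation (K s) h \<le> g s"
  shows "measure_pmf.expectation (p \<bind> K) h \<le> measure_pmf.expectation p g"
  using assms by (simp add: expectation_bind_finite expectation_mono_finite)

lemma expectation_linear_finite:
  fixes g h :: "'a \<Rightarrow> real"
  assumes "finite (set_pmf p)"
  shows "measure_pmf.expectation p (\<lambda>s. a * g s + c * h s)
    = a * measure_pmf.expectation p g + c * measure_pmf.expectation p h"
  using assms by (simp add: integrable_measure_pmf_finite)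

lemma expectation_affine_finite:
  fixes h :: "'a \<Rightarrow> real"
  assumes "finite (set_pmf p)"
  shows "measure_pmf.expectation p (\<lambda>s. a + c * h s) = a + c * measure_pmf.expectation p h"
  using expectation_linear_finite[OF assms, of a "\<lambda>_. 1" c h] by simp

lemma b_opt_in_range: "0 - b_opt V x \<in> range ((*v) (conj_transpose V))"
  unfolding b_opt_def diff_0 by (intro subspace_neg[OF subspace_range_mult_vec] rangeI)

lemma inj_imp_nonzero:
  fixes A :: "complex^'n^'m"
  assumes "inj ((*v) A)"
  shows "A \<noteq> 0"
proof
  assume "A = 0"
  moreover have "A *v axis undefined 1 \<noteq> A *v 0"
    using assms by (metis axis_eq_0_iff injD zero_neq_one)
  ultimately show False by simp
qed

lemma surj_imp_nonzero:
  fixes A :: "complex^'n^'m"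
  assumes "surj ((*v) A)"
  shows "A \<noteq> 0"
proof
  assume "A = 0"
  moreover obtain w where "axis undefined 1 = A *v w"
    using assms by blast
  ultimately show False by (simp add: axis_eq_0_iff)
qed

section \<open>Finite support and invariant subspaces of the joint laws\<close>

lemma finite_set_rk_rk: "finite (set_pmf (rk_rk U V y t))"
  by (induction t) (auto simp: Let_def split_def)

lemma finite_set_rek_rk: "finite (set_pmf (rek_rk U V y t))"
  by (induction t) (auto simp: Let_def split_def)

lemma rk_rk_in_range:
  "s \<in> set_pmf (rk_rk U V y t) \<Longrightarrow> snd s - b_opt V x \<in> range ((*v) (conj_transpose V))"
proof (induction t arbitrary: s)
  case 0
  then show ?case using b_opt_in_range by simp
next
  case (Suc t)
  then show ?case by (auto simp: Let_def split_def intro!: rk_step_diff_in_range)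
qed

text \<open>Initially \<open>z\<close> differs from \<open>y - U *v x0\<close> by
  \<open>U *v x0\<close>. Each \<open>z_step\<close> is a Kaczmarz step for the adjoint, whose row
  space is the range of \<open>U\<close>.\<close>

lemma rek_rk_in_range:
  fixes U :: "complex^'k^'m"
  assumes "s \<in> set_pmf (rek_rk U V y t)"
  shows "fst s - (y - U *v x0) \<in> range ((*v) U)
    \<and> snd (snd s) - b_opt V x \<in> range ((*v) (conj_transpose V))"
  using assms
proof (induction t arbitrary: s)
  case 0
  then show ?case using b_opt_in_range by simp
next
  case (Suc t)
  then show ?case
    using rk_step_diff_in_range[of _ _ "conj_transpose U"]
    by (auto simp: Let_def split_def z_step_eq_rk_step intro!: rk_step_diff_in_range)
qed

text \<open>Here \<open>f i\<close> is the freshly drawn inner iterate. Since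
  \<open>V *v b0 = x0\<close>, the outer residual at \<open>b0\<close> is exactly the inner error
  \<open>f i - x0\<close>.\<close>

lemma expectation_outer_step:
  fixes V :: "complex^'n^'k" and q :: "'i::finite pmf"
  assumes "V \<noteq> 0" "V *v b0 = x0" "b - b0 \<in> range ((*v) (conj_transpose V))"
  shows "measure_pmf.expectation q
      (\<lambda>i. measure_pmf.expectation (row_pmf V) (\<lambda>p. (norm (rk_step V (f i) p b - b0))\<^sup>2))
    \<le> alpha V * (norm (b - b0))\<^sup>2
      + 1 / (frob_norm V)\<^sup>2 * measure_pmf.expectation q (\<lambda>i. (norm (f i - x0))\<^sup>2)"
proof -
  have "measure_pmf.expectation (row_pmf V) (\<lambda>p. (norm (rk_step V (f i) p b - b0))\<^sup>2)
      \<le> alpha V * (norm (b - b0))\<^sup>2 + 1 / (frob_norm V)\<^sup>2 * (norm (f i - x0))\<^sup>2" for i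
    using expectation_rk_step_contraction[OF assms(1,3), of "f i"] assms(2) by simp
  then show ?thesis
    by (subst expectation_affine_finite[symmetric]) (auto intro: expectation_mono_finite)
qed

lemma rk_rk_Suc:
  "rk_rk U V y (Suc t) = rk_rk U V y t \<bind> (\<lambda>s. row_pmf U \<bind> (\<lambda>i. row_pmf V \<bind> (\<lambda>p.
     return_pmf (rk_step U y i (fst s), rk_step V (rk_step U y i (fst s)) p (snd s)))))"
  by (simp add: Let_def split_def)

text \<open>Independent draws commute. Drawing the column first fixes the new \<open>z\<close>
  before the row is averaged.\<close>

lemma rek_rk_Suc:
  "rek_rk U V y (Suc t) = rek_rk U V y t \<bind> (\<lambda>s. col_pmf U \<bind> (\<lambda>j. row_pmf U \<bind> (\<lambda>i. row_pmf V \<bind> (\<lambda>p.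
     return_pmf (z_step U j (fst s), rk_step U (y - z_step U j (fst s)) i (fst (snd s)),
       rk_step V (rk_step U (y - z_step U j (fst s)) i (fst (snd s))) p (snd (snd s)))))))"
  unfolding rek_rk.simps Let_def split_def
  by (subst bind_commute_pmf) (rule refl)

section \<open>Mean squared error of RK-RK\<close>

text \<open>Consistency removes the additive term from the inner recurrence. The outer step uses the
  already updated \<open>x\<close>, which supplies the extra factor \<open>alpha U\<close> in front
  of the sum.\<close>

lemma rk_rk_err_le:
  fixes U :: "complex^'k^'m" and V :: "complex^'n^'k"
  assumes U: "inj ((*v) U)" and V: "surj ((*v) V)" and x0: "U *v x0 = y"
  defines "b0 \<equiv> b_opt V x0"
  shows "rk_rk_err U V y t b0 \<le> alpha V ^ t * (norm b0)\<^sup>2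
    + alpha U * (norm x0)\<^sup>2 / (frob_norm V)\<^sup>2 * (\<Sum>i<t. alpha V ^ (t - 1 - i) * alpha U ^ i)"
proof -
  have U0: "U \<noteq> 0" and V0: "V \<noteq> 0"
    using U V by (simp_all add: inj_imp_nonzero surj_imp_nonzero)
  note aU = alpha_nonneg[OF U0] and aV = alpha_nonneg[OF V0]
  define C where "C t = measure_pmf.expectation (rk_rk U V y t) (\<lambda>s. (norm (fst s - x0))\<^sup>2)" for t
  define D where "D t = measure_pmf.expectation (rk_rk U V y t) (\<lambda>s. (norm (snd s - b0))\<^sup>2)" for t
  let ?F = "(frob_norm V)\<^sup>2"
  have inner: "measure_pmf.expectation (row_pmf U) (\<lambda>i. (norm (rk_step U y i x - x0))\<^sup>2)
      \<le> alpha U * (norm (x - x0))\<^sup>2" for x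
    using expectation_rk_step_contraction[OF U0, of x x0 y] range_conj_transpose_UNIV[OF U]
    by (simp add: x0)
  have C: "C (Suc t) \<le> alpha U * C t" for t
  proof -
    have "C (Suc t) \<le> measure_pmf.expectation (rk_rk U V y t) (\<lambda>s. alpha U * (norm (fst s - x0))\<^sup>2)"
      unfolding C_def rk_rk_Suc
      by (rule expectation_bind_le) (auto simp: finite_set_rk_rk expectation_bind_finite inner)
    then show ?thesis by (simp add: C_def)
  qed
  have C_le: "C t \<le> alpha U ^ t * (norm x0)\<^sup>2" for t
  proof (induction t)
    case (Suc t)
    then have "alpha U * C t \<le> alpha U * (alpha U ^ t * (norm x0)\<^sup>2)"
      using aU by (rule mult_left_mono)
    with C[of t] show ?case by (simp add: mult.assoc)
  qed (simp add: C_def)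
  have D: "D (Suc t) \<le> alpha V * D t + alpha U * (norm x0)\<^sup>2 / ?F * alpha U ^ t" for t
  proof -
    have "D (Suc t) \<le> measure_pmf.expectation (rk_rk U V y t)
        (\<lambda>s. alpha V * (norm (snd s - b0))\<^sup>2 + alpha U / ?F * (norm (fst s - x0))\<^sup>2)"
      unfolding D_def rk_rk_Suc
    proof (rule expectation_bind_le)
      fix s assume s: "s \<in> set_pmf (rk_rk U V y t)"
      have "alpha V * (norm (snd s - b0))\<^sup>2 + 1 / ?F * measure_pmf.expectation (row_pmf U)
          (\<lambda>i. (norm (rk_step U y i (fst s) - x0))\<^sup>2)
        \<le> alpha V * (norm (snd s - b0))\<^sup>2 + 1 / ?F * (alpha U * (norm (fst s - x0))\<^sup>2)"
        using inner by (intro add_left_mono mult_left_mono) auto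
      then show "measure_pmf.expectation (row_pmf U \<bind> (\<lambda>i. row_pmf V \<bind> (\<lambda>p.
          return_pmf (rk_step U y i (fst s), rk_step V (rk_step U y i (fst s)) p (snd s)))))
          (\<lambda>s. (norm (snd s - b0))\<^sup>2)
        \<le> alpha V * (norm (snd s - b0))\<^sup>2 + alpha U / ?F * (norm (fst s - x0))\<^sup>2"
        using expectation_outer_step[OF V0 mult_b_opt[OF V] rk_rk_in_range[OF s],
            of "row_pmf U" "\<lambda>i. rk_step U y i (fst s)" x0]
        by (simp add: expectation_bind_finite b0_def)
    qed (auto simp: finite_set_rk_rk)
    also have "\<dots> = alpha V * D t + alpha U / ?F * C t"
      unfolding C_def D_def by (rule expectation_linear_finite[OF finite_set_rk_rk])
    also have "\<dots> \<le> alpha V * D t + alpha U / ?F * (alpha U ^ t * (norm x0)\<^sup>2)"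
      using aU C_le by (intro add_left_mono mult_left_mono) auto
    finally show ?thesis by (simp add: mult_ac)
  qed
  have "D 0 = (norm b0)\<^sup>2" by (simp add: D_def)
  then show ?thesis
    using linear_recurrence_le[of D, OF D aV, of t]
    by (simp add: rk_rk_err_def D_def split_def)
qed

section \<open>Mean squared error of REK-RK\<close>

text \<open>\<open>sigma_min\<close> cancels in \<open>kappa_sq U * (1 - alpha U)\<close>, leaving
  the squared ratio of \<open>sigma_max\<close> to the Frobenius norm. The factor
  \<open>1 - alpha U\<close> is what later offsets the linear growth in \<open>t\<close>.\<close>

lemma norm_mult_vec_le_kappa:
  fixes U :: "complex^'k^'m"
  assumes "U \<noteq> 0"
  shows "(norm (U *v x))\<^sup>2 / (frob_norm U)\<^sup>2 \<le> kappa_sq U * (1 - alpha U) * (norm x)\<^sup>2"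
proof -
  have "kappa_sq U * (1 - alpha U) = (sigma_max U)\<^sup>2 / (frob_norm U)\<^sup>2"
    using sigma_min_pos[OF assms] by (simp add: kappa_sq_def alpha_def)
  then show ?thesis
    using mult_vec_le_sigma_max[of U x] by (simp add: divide_right_mono)
qed

text \<open>Three errors form a cascade: \<open>A\<close> for \<open>z\<close> drives
  \<open>C\<close> for \<open>x\<close>, which drives \<open>D\<close> for \<open>b\<close>.\<close>

lemma rek_rk_err_le:
  fixes U :: "complex^'k^'m" and V :: "complex^'n^'k" and y :: "complex^'m"
  assumes U: "inj ((*v) U)" and V: "surj ((*v) V)"
  defines "x0 \<equiv> x_opt U y" and "b0 \<equiv> b_opt V (x_opt U y)"
  shows "rek_rk_err U V y t b0 \<le> alpha V ^ t * (norm b0)\<^sup>2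
    + (1 + 2 * kappa_sq U) * (norm x0)\<^sup>2 / (frob_norm V)\<^sup>2
      * (\<Sum>i<t. alpha V ^ (t - 1 - i) * sqrt (alpha U) ^ i)"
proof -
  have U0: "U \<noteq> 0" and V0: "V \<noteq> 0"
    using U V by (simp_all add: inj_imp_nonzero surj_imp_nonzero)
  note aU = alpha_nonneg[OF U0] and aV = alpha_nonneg[OF V0]
  let ?F = "(frob_norm V)\<^sup>2" and ?G = "(frob_norm U)\<^sup>2" and ?q = "sqrt (alpha U)"
  have Vb0: "V *v b0 = x0" by (simp add: b0_def x0_def mult_b_opt[OF V])
  \<comment> \<open>The least-squares residual is the target of \<open>z\<close>; replacing
    \<open>z\<close> by \<open>r\<close> would make the inner system consistent, because
    \<open>y - r = U *v x0\<close>.\<close>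
  define r where "r = y - U *v x0"
  have r: "conj_transpose U *v r = 0"
    using normal_equation_x_opt[OF U, of y]
    by (simp add: r_def x0_def matrix_vector_mult_diff_distrib)
  define A where "A t = measure_pmf.expectation (rek_rk U V y t) (\<lambda>s. (norm (fst s - r))\<^sup>2)" for t
  define C where "C t = measure_pmf.expectation (rek_rk U V y t) (\<lambda>s. (norm (fst (snd s) - x0))\<^sup>2)" for t
  define D where "D t = measure_pmf.expectation (rek_rk U V y t) (\<lambda>s. (norm (snd (snd s) - b0))\<^sup>2)" for t
  \<comment> \<open>The scaled initial error of \<open>z\<close>: \<open>z\<close> starts at
    \<open>y\<close>, and \<open>y - r = U *v x0\<close>.\<close>
  define a0 where "a0 = (norm (U *v x0))\<^sup>2 / ?G"
  have z_in: "fst s - r \<in> range ((*v) U)"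
    and b_in: "snd (snd s) - b0 \<in> range ((*v) (conj_transpose V))"
    if "s \<in> set_pmf (rek_rk U V y t)" for s t
    using rek_rk_in_range[OF that] by (simp_all add: r_def b0_def)
  have inner: "measure_pmf.expectation (col_pmf U) (\<lambda>j. measure_pmf.expectation (row_pmf U)
        (\<lambda>i. (norm (rk_step U (y - z_step U j z) i x - x0))\<^sup>2))
      \<le> alpha U * (norm (x - x0))\<^sup>2 + alpha U / ?G * (norm (z - r))\<^sup>2"
    if "z - r \<in> range ((*v) U)" for x z
  proof -
    have "measure_pmf.expectation (col_pmf U) (\<lambda>j. measure_pmf.expectation (row_pmf U)
        (\<lambda>i. (norm (rk_step U (y - z_step U j z) i x - x0))\<^sup>2))
      \<le> measure_pmf.expectation (col_pmf U)
        (\<lambda>j. alpha U * (norm (x - x0))\<^sup>2 + 1 / ?G * (norm (z_step U j z - r))\<^sup>2)"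
    proof (rule expectation_mono_finite)
      fix j
      have "y - z_step U j z - U *v x0 = - (z_step U j z - r)" by (simp add: r_def)
      then have "norm (y - z_step U j z - U *v x0) = norm (z_step U j z - r)"
        by (simp only: norm_minus_cancel)
      then show "measure_pmf.expectation (row_pmf U)
          (\<lambda>i. (norm (rk_step U (y - z_step U j z) i x - x0))\<^sup>2)
        \<le> alpha U * (norm (x - x0))\<^sup>2 + 1 / ?G * (norm (z_step U j z - r))\<^sup>2"
        using expectation_rk_step_contraction[OF U0, of x x0 "y - z_step U j z"]
          range_conj_transpose_UNIV[OF U] by simp
    qed simp
    also have "\<dots> = alpha U * (norm (x - x0))\<^sup>2
        + 1 / ?G * measure_pmf.expectation (col_pmf U) (\<lambda>j. (norm (z_step U j z - r))\<^sup>2)"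
      by (rule expectation_affine_finite) simp
    also have "\<dots> \<le> alpha U * (norm (x - x0))\<^sup>2 + 1 / ?G * (alpha U * (norm (z - r))\<^sup>2)"
      using expectation_z_step_contraction[OF U0 U that r]
      by (intro add_left_mono mult_left_mono) auto
    finally show ?thesis by simp
  qed
  have A: "A (Suc t) \<le> alpha U * A t" for t
  proof -
    have "A (Suc t) \<le> measure_pmf.expectation (rek_rk U V y t) (\<lambda>s. alpha U * (norm (fst s - r))\<^sup>2)"
      unfolding A_def rek_rk_Suc
      by (rule expectation_bind_le)
        (auto simp: finite_set_rek_rk expectation_bind_finite
          intro: expectation_z_step_contraction[OF U0 U _ r] dest: z_in)
    then show ?thesis by (simp add: A_def)
  qed
  have A_le: "A t / ?G \<le> alpha U ^ t * a0" for t
  proof (induction t)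
    case 0
    show ?case by (simp add: A_def a0_def r_def)
  next
    case (Suc t)
    then have "alpha U * (A t / ?G) \<le> alpha U * (alpha U ^ t * a0)"
      using aU by (rule mult_left_mono)
    moreover have "A (Suc t) / ?G \<le> alpha U * A t / ?G"
      using A by (rule divide_right_mono) simp
    ultimately show ?case by (simp add: mult.assoc)
  qed
  have C: "C (Suc t) \<le> alpha U * (C t + A t / ?G)" for t
  proof -
    have "C (Suc t) \<le> measure_pmf.expectation (rek_rk U V y t)
        (\<lambda>s. alpha U * (norm (fst (snd s) - x0))\<^sup>2 + alpha U / ?G * (norm (fst s - r))\<^sup>2)"
      unfolding C_def rek_rk_Suc
      by (rule expectation_bind_le)
        (simp_all add: finite_set_rek_rk expectation_bind_finite inner[OF z_in, simplified])
    also have "\<dots> = alpha U * C t + alpha U / ?G * A t"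
      unfolding C_def A_def by (rule expectation_linear_finite[OF finite_set_rek_rk])
    finally show ?thesis by (simp add: algebra_simps)
  qed
  \<comment> \<open>The input decays at the same rate as the recurrence itself, so every step
    contributes another \<open>a0\<close> and a factor \<open>t\<close> appears.\<close>
  have C_le: "C t \<le> alpha U ^ t * ((norm x0)\<^sup>2 + real t * a0)" for t
  proof (induction t)
    case (Suc t)
    have "alpha U * (C t + A t / ?G) \<le> alpha U *
        (alpha U ^ t * ((norm x0)\<^sup>2 + real t * a0) + alpha U ^ t * a0)"
      using aU Suc A_le[of t] by (intro mult_left_mono add_mono)
    with C[of t] show ?case by (simp add: algebra_simps)
  qed (simp add: C_def)
  \<comment> \<open>The left side bounds the error of the next \<open>x\<close>, which enters the
    outer step. Passing to the rate \<open>sqrt (alpha U)\<close> absorbs the linear factor.\<close>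
  have CA_le: "alpha U * (C t + A t / ?G) \<le> ?q ^ t * ((1 + 2 * kappa_sq U) * (norm x0)\<^sup>2)" for t
  proof -
    have k: "0 \<le> kappa_sq U" by (simp add: kappa_sq_def)
    have q: "?q\<^sup>2 = alpha U" using aU by simp
    have a0: "a0 \<le> kappa_sq U * (1 - alpha U) * (norm x0)\<^sup>2"
      unfolding a0_def using norm_mult_vec_le_kappa[OF U0] .
    have "alpha U * (C t + A t / ?G) \<le> alpha U *
        (alpha U ^ t * ((norm x0)\<^sup>2 + real t * a0) + alpha U ^ t * a0)"
      using aU C_le A_le by (intro mult_left_mono add_mono)
    also have "\<dots> = alpha U ^ Suc t * ((norm x0)\<^sup>2 + real (Suc t) * a0)"
      by (simp add: algebra_simps)
    also have "\<dots> \<le> alpha U ^ Suc t * ((norm x0)\<^sup>2 + real (Suc t) * (kappa_sq U * (1 - alpha U) * (norm x0)\<^sup>2))"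
      using a0 aU by (intro mult_left_mono add_left_mono) auto
    also have "\<dots> = (?q\<^sup>2) ^ Suc t * (1 + real (Suc t) * (kappa_sq U * (1 - ?q\<^sup>2))) * (norm x0)\<^sup>2"
      unfolding q by (simp add: algebra_simps)
    also have "\<dots> \<le> ?q ^ t * (1 + 2 * kappa_sq U) * (norm x0)\<^sup>2"
      using power_linear_factor_le[of ?q "kappa_sq U" t] k aU alpha_le_1[of U]
      by (intro mult_right_mono) auto
    finally show ?thesis by (simp only: mult.assoc)
  qed
  have D: "D (Suc t) \<le> alpha V * D t + (1 + 2 * kappa_sq U) * (norm x0)\<^sup>2 / ?F * ?q ^ t" for t
  proof -
    have "D (Suc t) \<le> measure_pmf.expectation (rek_rk U V y t)
        (\<lambda>s. alpha V * (norm (snd (snd s) - b0))\<^sup>2 + 1 / ?F *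
          (alpha U * (norm (fst (snd s) - x0))\<^sup>2 + alpha U / ?G * (norm (fst s - r))\<^sup>2))"
      unfolding D_def rek_rk_Suc
    proof (rule expectation_bind_le)
      fix s assume s: "s \<in> set_pmf (rek_rk U V y t)"
      let ?x = "\<lambda>j i. rk_step U (y - z_step U j (fst s)) i (fst (snd s))"
      have "measure_pmf.expectation (col_pmf U \<bind> (\<lambda>j. row_pmf U \<bind> (\<lambda>i. row_pmf V \<bind> (\<lambda>p.
          return_pmf (z_step U j (fst s), ?x j i, rk_step V (?x j i) p (snd (snd s)))))))
          (\<lambda>s. (norm (snd (snd s) - b0))\<^sup>2)
        = measure_pmf.expectation (col_pmf U) (\<lambda>j. measure_pmf.expectation (row_pmf U) (\<lambda>i.
            measure_pmf.expectation (row_pmf V) (\<lambda>p. (norm (rk_step V (?x j i) p (snd (snd s)) - b0))\<^sup>2)))"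
        by (simp add: expectation_bind_finite)
      also have "\<dots> \<le> measure_pmf.expectation (col_pmf U) (\<lambda>j. alpha V * (norm (snd (snd s) - b0))\<^sup>2
          + 1 / ?F * measure_pmf.expectation (row_pmf U) (\<lambda>i. (norm (?x j i - x0))\<^sup>2))"
        by (rule expectation_mono_finite, simp, rule expectation_outer_step[OF V0 Vb0 b_in[OF s]])
      also have "\<dots> = alpha V * (norm (snd (snd s) - b0))\<^sup>2 + 1 / ?F *
          measure_pmf.expectation (col_pmf U) (\<lambda>j. measure_pmf.expectation (row_pmf U) (\<lambda>i. (norm (?x j i - x0))\<^sup>2))"
        by (rule expectation_affine_finite) simp
      also have "\<dots> \<le> alpha V * (norm (snd (snd s) - b0))\<^sup>2 + 1 / ?F *
          (alpha U * (norm (fst (snd s) - x0))\<^sup>2 + alpha U / ?G * (norm (fst s - r))\<^sup>2)"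
        using inner[OF z_in[OF s]] by (intro add_left_mono mult_left_mono) auto
      finally show "measure_pmf.expectation (col_pmf U \<bind> (\<lambda>j. row_pmf U \<bind> (\<lambda>i. row_pmf V \<bind> (\<lambda>p.
          return_pmf (z_step U j (fst s), ?x j i, rk_step V (?x j i) p (snd (snd s)))))))
          (\<lambda>s. (norm (snd (snd s) - b0))\<^sup>2) \<le> \<dots>" .
    qed (auto simp: finite_set_rek_rk)
    also have "\<dots> = alpha V * D t + 1 / ?F * (alpha U * C t + alpha U / ?G * A t)"
      unfolding A_def C_def D_def by (simp only: expectation_linear_finite[OF finite_set_rek_rk])
    also have "\<dots> \<le> alpha V * D t + 1 / ?F * (?q ^ t * ((1 + 2 * kappa_sq U) * (norm x0)\<^sup>2))"
      using CA_le[of t] by (intro add_left_mono mult_left_mono) (auto simp: algebra_simps)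
    finally show ?thesis by (simp add: mult_ac)
  qed
  have "D 0 = (norm b0)\<^sup>2" by (simp add: D_def)
  then show ?thesis
    using linear_recurrence_le[of D, OF D aV, of t]
    by (simp add: rek_rk_err_def D_def split_def)
qed

section \<open>Closed-form bounds for the consistent and the inconsistent case\<close>

theorem theorem1:
  fixes U :: "complex^'k^'m" and V :: "complex^'n^'k" and X :: "complex^'n^'m"
    and y :: "complex^'m"
    and beta_star b_star :: "complex^'n" and x_star :: "complex^'k"
    and alpha_max gamma1 alpha_max' gamma2 :: real
  assumes "CARD('k) < min CARD('m) CARD('n)"
    and "full_rank U" and "full_rank V"
    and "X = U ** V"
    and "beta_star = min_norm_lsq X y"
    and "x_star = x_opt U y"
    and "b_star = b_opt V x_star"
    and "alpha_max = max (alpha U) (alpha V)"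
    and "gamma1 = min (alpha U / alpha V) (alpha V / alpha U)"
    and "alpha_max' = max (sqrt (alpha U)) (alpha V)"
    and "gamma2 = min (sqrt (alpha U) / alpha V) (alpha V / sqrt (alpha U))"
  shows "(consistent X y \<longrightarrow>
            b_star = beta_star \<and>
            (\<forall>t\<ge>1. rk_rk_err U V y t beta_star \<le>
              (if alpha U \<noteq> alpha V
               then alpha V ^ t * (norm b_star)\<^sup>2
                    + inverse (1 - gamma1) * alpha_max ^ t * ((norm x_star)\<^sup>2 / (frob_norm V)\<^sup>2)
               else alpha V ^ t * (norm b_star)\<^sup>2
                    + real t * alpha_max ^ t * ((norm x_star)\<^sup>2 / (frob_norm V)\<^sup>2)))) \<and>
         (\<not> consistent X y \<longrightarrow>
            b_star = beta_star \<and>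
            (\<forall>t\<ge>1. rek_rk_err U V y t beta_star \<le>
              (if sqrt (alpha U) \<noteq> alpha V
               then alpha V ^ t * (norm b_star)\<^sup>2
                    + inverse (1 - gamma2) * alpha_max' ^ (t - 1)
                      * ((1 + 2 * kappa_sq U) * (norm x_star)\<^sup>2 / (frob_norm V)\<^sup>2)
               else alpha V ^ t * (norm b_star)\<^sup>2
                    + real t * alpha_max' ^ (t - 1)
                      * ((1 + 2 * kappa_sq U) * (norm x_star)\<^sup>2 / (frob_norm V)\<^sup>2))))"
proof -
  have U: "inj ((*v) U)" and V: "surj ((*v) V)"
    using assms(1-3) by (auto intro!: full_rank_imp_inj full_rank_imp_surj)
  have aU: "0 \<le> alpha U" and aV: "0 \<le> alpha V"
    using U V by (simp_all add: alpha_nonneg inj_imp_nonzero surj_imp_nonzero)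
  have b: "b_star = b_opt V (x_opt U y)" "b_star = beta_star"
    using min_norm_lsq_factorization[OF U V, of y] assms(4-7) by simp_all
  let ?F = "(frob_norm V)\<^sup>2"
  have rk: "rk_rk_err U V y t beta_star \<le> alpha V ^ t * (norm b_star)\<^sup>2
      + (if alpha U \<noteq> alpha V then inverse (1 - gamma1) else real t)
        * alpha_max ^ t * ((norm x_star)\<^sup>2 / ?F)"
    if cons: "consistent X y" and t: "t \<ge> 1" for t
  proof -
    define S where "S = (\<Sum>i<t. alpha V ^ (t - 1 - i) * alpha U ^ i)"
    define g where "g = (if alpha U \<noteq> alpha V then inverse (1 - gamma1) else real t)"
    obtain \<beta> where "U *v (V *v \<beta>) = y"
      using cons by (auto simp: consistent_def assms(4) simp flip: matrix_vector_mul_assoc)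
    \<comment> \<open>Both \<open>V *v \<beta>\<close> and \<open>x_star\<close> satisfy the normal
      equations, so in the consistent case \<open>x_star\<close> solves the inner system
      exactly.\<close>
    then have "U *v (V *v \<beta> - x_star) = 0"
      using conj_transpose_mult_eq_0D[of U "V *v \<beta> - x_star"] normal_equation_x_opt[OF U, of y]
      by (simp add: assms(6) matrix_vector_mult_diff_distrib)
    with \<open>U *v (V *v \<beta>) = y\<close> have x: "U *v x_star = y"
      by (simp add: matrix_vector_mult_diff_distrib)
    have "S \<le> g * alpha_max ^ (t - 1)"
      using mixed_power_sum_le[OF aV aU, of t] by (simp only: S_def g_def assms(8,9))
    \<comment> \<open>The spare factor \<open>alpha U\<close>, at most \<open>alpha_max\<close>,
      raises the exponent from \<open>t - 1\<close> to \<open>t\<close>; this uses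
      \<open>t \<ge> 1\<close>.\<close>
    then have "alpha U * S \<le> alpha_max * (g * alpha_max ^ (t - 1))"
      using aU by (intro mult_mono) (auto simp: S_def assms(8) aV intro!: sum_nonneg)
    also have "\<dots> = g * alpha_max ^ t"
      using t by (simp add: power_eq_if)
    finally have "alpha U * S * ((norm x_star)\<^sup>2 / ?F) \<le> g * alpha_max ^ t * ((norm x_star)\<^sup>2 / ?F)"
      by (rule mult_right_mono) simp
    moreover have "rk_rk_err U V y t beta_star \<le> alpha V ^ t * (norm b_star)\<^sup>2
        + alpha U * S * ((norm x_star)\<^sup>2 / ?F)"
      using rk_rk_err_le[OF U V x, of t] b assms(6) by (simp add: S_def mult_ac)
    ultimately show ?thesis unfolding g_def by linarith
  qed
  have rek: "rek_rk_err U V y t beta_star \<le> alpha V ^ t * (norm b_star)\<^sup>2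
      + (if sqrt (alpha U) \<noteq> alpha V then inverse (1 - gamma2) else real t)
        * alpha_max' ^ (t - 1) * ((1 + 2 * kappa_sq U) * (norm x_star)\<^sup>2 / ?F)" for t
  proof -
    define S where "S = (\<Sum>i<t. alpha V ^ (t - 1 - i) * sqrt (alpha U) ^ i)"
    define g where "g = (if sqrt (alpha U) \<noteq> alpha V then inverse (1 - gamma2) else real t)"
    define K where "K = (1 + 2 * kappa_sq U) * (norm x_star)\<^sup>2 / ?F"
    have "0 \<le> K" by (simp add: K_def kappa_sq_def)
    moreover have "S \<le> g * alpha_max' ^ (t - 1)"
      using mixed_power_sum_le[OF aV, of "sqrt (alpha U)" t] aU
      by (simp only: S_def g_def assms(10,11) real_sqrt_ge_zero)
    ultimately have "K * S \<le> g * alpha_max' ^ (t - 1) * K"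
      by (metis mult.commute mult_left_mono)
    moreover have "rek_rk_err U V y t beta_star \<le> alpha V ^ t * (norm b_star)\<^sup>2 + K * S"
      using rek_rk_err_le[OF U V, of y t] b assms(6) by (simp add: S_def K_def)
    ultimately show ?thesis unfolding g_def K_def by linarith
  qed
  show ?thesis
    using rk rek b(2) by (auto split: if_splits)
qed

end
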